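(* There is an algorithm that, given a connected graph $G$ with $n$ vertices and $m$ edges, in $O(n+m)$ time either (a) correctly decides that $G$ is not $(P_2+2P_1)$-free, or (b) outputs a shortest path of $G$ which, if $G$ is $(P_2+2P_1)$-free, is a diametral path of $G$ (i.e., a shortest path between two vertices at distance $\operatorname{diam}(G)$).
   Context: Graphs are finite, simple, undirected and unweighted. A graph is $H$-free if it does not contain $H$ as an induced subgraph. $P_t$ is the path on $t$ vertices; $P_2+2P_1$ is the disjoint union of an edge and two isolated vertices. $\operatorname{diam}(G)=\max_{u,v}d(u,v)$ with $d$ the shortest-path distance. *)

theory Defs
  imports Main
begin

section \<open>Graphs\<close>

datatype 'a graph = Graph (verts: "'a set") (edges: "'a set set")

definition simple_graph :: "'a graph \<Rightarrow> bool" where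
  "simple_graph G \<longleftrightarrow>
     finite (verts G) \<and> (\<forall>e\<in>edges G. \<exists>u v. e = {u, v} \<and> u \<in> verts G \<and> v \<in> verts G \<and> u \<noteq> v)"

definition induced_subgraph :: "'a graph \<Rightarrow> 'a set \<Rightarrow> 'a graph" where
  "induced_subgraph G S = Graph S {e \<in> edges G. e \<subseteq> S}"

definition isomorphic :: "'a graph \<Rightarrow> 'b graph \<Rightarrow> bool" where
  "isomorphic G H \<longleftrightarrow>
     (\<exists>f. bij_betw f (verts G) (verts H) \<and>
          (\<forall>u\<in>verts G. \<forall>v\<in>verts G. {u, v} \<in> edges G \<longleftrightarrow> {f u, f v} \<in> edges H))"

definition free_of :: "'a graph \<Rightarrow> 'b graph \<Rightarrow> bool" where
  "free_of G H \<longleftrightarrow> \<not> (\<exists>S \<subseteq> verts G. isomorphic (induced_subgraph G S) H)"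

definition path_graph :: "nat \<Rightarrow> nat graph" where
  "path_graph t = Graph {0..<t} {{i, Suc i} |i. Suc i < t}"

definition disjoint_union :: "'a graph \<Rightarrow> 'b graph \<Rightarrow> ('a + 'b) graph" where
  "disjoint_union G H =
     Graph (Inl ` verts G \<union> Inr ` verts H) ((`) Inl ` edges G \<union> (`) Inr ` edges H)"

definition P2_plus_2P1 :: "(nat + (nat + nat)) graph" where
  "P2_plus_2P1 =
     disjoint_union (path_graph 2) (disjoint_union (path_graph 1) (path_graph 1))"

text \<open>A path is given by the nonempty list of its vertices; its length is the number of its
  edges, that is, one less than the length of the list.\<close>

definition is_path :: "'a graph \<Rightarrow> 'a list \<Rightarrow> bool" where
  "is_path G p \<longleftrightarrow>
     p \<noteq> [] \<and> distinct p \<and> set p \<subseteq> verts G \<and>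
     (\<forall>i. Suc i < length p \<longrightarrow> {p ! i, p ! Suc i} \<in> edges G)"

definition path_between :: "'a graph \<Rightarrow> 'a \<Rightarrow> 'a list \<Rightarrow> 'a \<Rightarrow> bool" where
  "path_between G u p v \<longleftrightarrow> is_path G p \<and> hd p = u \<and> last p = v"

definition connected_graph :: "'a graph \<Rightarrow> bool" where
  "connected_graph G \<longleftrightarrow>
     verts G \<noteq> {} \<and> (\<forall>u\<in>verts G. \<forall>v\<in>verts G. \<exists>p. path_between G u p v)"

text \<open>The distance is meaningful only for vertices joined by a path; it is used only for
  connected graphs.\<close>

definition graph_dist :: "'a graph \<Rightarrow> 'a \<Rightarrow> 'a \<Rightarrow> nat" where
  "graph_dist G u v = (LEAST k. \<exists>p. path_between G u p v \<and> length p - 1 = k)"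

definition diam :: "'a graph \<Rightarrow> nat" where
  "diam G = Max {graph_dist G u v |u v. u \<in> verts G \<and> v \<in> verts G}"

definition shortest_path :: "'a graph \<Rightarrow> 'a list \<Rightarrow> bool" where
  "shortest_path G p \<longleftrightarrow> is_path G p \<and> length p - 1 = graph_dist G (hd p) (last p)"

definition diametral_path :: "'a graph \<Rightarrow> 'a list \<Rightarrow> bool" where
  "diametral_path G p \<longleftrightarrow> shortest_path G p \<and> graph_dist G (hd p) (last p) = diam G"


section \<open>Model of computation\<close>

text \<open>
  Algorithms are programs for a random access machine with logarithmic word length, written
  with structured control flow. A program refers to finitely many scalar variables (registers)
  and finitely many arrays of natural numbers, which are addressed indirectly. Operands of
  instructions are scalar variables or constants, so every instruction and every test touches
  a bounded number of words and takes one unit of time.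

  A constant number of arrays can be interleaved in a single memory and the control structures
  compile to jumps, so this is a usual RAM up to constant factors in the running time.
\<close>

type_synonym name = string

datatype operand = Const nat | Var name

datatype rhs =
    Opd operand
  | Add operand operand
  | Sub operand operand
  | Mul operand operand
  | Read name operand

datatype test =
    Less operand operand
  | LessEq operand operand
  | Equal operand operand
  | NotEqual operand operand

datatype program =
    Skip
  | Assign name rhs
  | Write name operand operand
  | Seq program program
  | If test program program
  | While test program

record state =
  scalar :: "name \<Rightarrow> nat"
  array :: "name \<Rightarrow> nat \<Rightarrow> nat"

fun operand_val :: "operand \<Rightarrow> state \<Rightarrow> nat" where
  "operand_val (Const k) s = k"
| "operand_val (Var x) s = scalar s x"

text \<open>Subtraction is truncated at zero.\<close>

fun rhs_val :: "rhs \<Rightarrow> state \<Rightarrow> nat" where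
  "rhs_val (Opd a) s = operand_val a s"
| "rhs_val (Add a b) s = operand_val a s + operand_val b s"
| "rhs_val (Sub a b) s = operand_val a s - operand_val b s"
| "rhs_val (Mul a b) s = operand_val a s * operand_val b s"
| "rhs_val (Read A i) s = array s A (operand_val i s)"

fun test_val :: "test \<Rightarrow> state \<Rightarrow> bool" where
  "test_val (Less a b) s = (operand_val a s < operand_val b s)"
| "test_val (LessEq a b) s = (operand_val a s \<le> operand_val b s)"
| "test_val (Equal a b) s = (operand_val a s = operand_val b s)"
| "test_val (NotEqual a b) s = (operand_val a s \<noteq> operand_val b s)"

definition set_scalar :: "name \<Rightarrow> nat \<Rightarrow> state \<Rightarrow> state" where
  "set_scalar x v s = s\<lparr>scalar := (scalar s)(x := v)\<rparr>"

definition set_array :: "name \<Rightarrow> nat \<Rightarrow> nat \<Rightarrow> state \<Rightarrow> state" where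
  "set_array A i v s = s\<lparr>array := (array s)(A := (array s A)(i := v))\<rparr>"

text \<open>\<open>exec W c s t s'\<close>: started in state \<open>s\<close>, the program \<open>c\<close> halts in state \<open>s'\<close> after \<open>t\<close>
  time units, and every value it stores is at most the word bound \<open>W\<close>. An instruction that
  would store a larger value is stuck: there is then no execution.\<close>

inductive exec :: "nat \<Rightarrow> program \<Rightarrow> state \<Rightarrow> nat \<Rightarrow> state \<Rightarrow> bool" for W :: nat where
  Skip: "exec W Skip s 1 s"
| Assign: "rhs_val r s \<le> W \<Longrightarrow> exec W (Assign x r) s 1 (set_scalar x (rhs_val r s) s)"
| Write: "operand_val i s \<le> W \<Longrightarrow> operand_val a s \<le> W \<Longrightarrow>
    exec W (Write A i a) s 1 (set_array A (operand_val i s) (operand_val a s) s)"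
| Seq: "exec W c1 s t1 s1 \<Longrightarrow> exec W c2 s1 t2 s2 \<Longrightarrow> exec W (Seq c1 c2) s (t1 + t2) s2"
| IfTrue: "test_val b s \<Longrightarrow> exec W c1 s t s1 \<Longrightarrow> exec W (If b c1 c2) s (1 + t) s1"
| IfFalse: "\<not> test_val b s \<Longrightarrow> exec W c2 s t s1 \<Longrightarrow> exec W (If b c1 c2) s (1 + t) s1"
| WhileFalse: "\<not> test_val b s \<Longrightarrow> exec W (While b c) s 1 s"
| WhileTrue: "test_val b s \<Longrightarrow> exec W c s t1 s1 \<Longrightarrow> exec W (While b c) s1 t2 s2 \<Longrightarrow>
    exec W (While b c) s (1 + t1 + t2) s2"

lemma exec_deterministic:
  "exec W c s t s1 \<Longrightarrow> exec W c s t' s1' \<Longrightarrow> t' = t \<and> s1' = s1"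
proof (induction arbitrary: t' s1' rule: exec.induct)
  case (Seq c1 s t1 s1 c2 t2 s2)
  from Seq.prems show ?case
    by (cases rule: exec.cases) (use Seq.IH in blast)+
next
  case (WhileTrue b s c t1 s1 t2 s2)
  from WhileTrue.prems show ?case
    by (cases rule: exec.cases) (use WhileTrue.IH WhileTrue.hyps in blast)+
qed (erule exec.cases; auto)+


section \<open>Input and output\<close>

text \<open>A graph with \<open>n\<close> vertices, numbered \<open>0, \<dots>, n - 1\<close>, is given by adjacency lists: the
  \<open>v\<close>-th list contains the neighbours of \<open>v\<close>, each once, in any order.\<close>

definition adjacency_lists :: "nat graph \<Rightarrow> nat list list \<Rightarrow> bool" where
  "adjacency_lists G L \<longleftrightarrow>
     verts G = {0..<length L} \<and>
     (\<forall>v < length L. distinct (L ! v) \<and> set (L ! v) = {u. {v, u} \<in> edges G})"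

text \<open>The adjacency lists are stored one after the other in the array \<open>adj\<close>; the list of \<open>v\<close>
  occupies the positions from \<open>off[v]\<close> to \<open>off[v+1] - 1\<close>. All other memory is zero.\<close>

definition input_state :: "nat list list \<Rightarrow> state" where
  "input_state L =
     \<lparr>scalar = (\<lambda>_. 0)(''n'' := length L),
      array = (\<lambda>_ _. 0)
        (''off'' := (\<lambda>i. if i \<le> length L then length (concat (take i L)) else 0),
         ''adj'' := (\<lambda>i. if i < length (concat L) then concat L ! i else 0))\<rparr>"

definition result_of :: "state \<Rightarrow> nat list option" where
  "result_of s =
     (if scalar s ''reject'' \<noteq> 0 then None
      else Some (map (array s ''out'') [0..<scalar s ''len'']))"

text \<open>Both constants hidden in the running time \<open>O(n + m)\<close> and in the word length
  \<open>O(log (n + m))\<close> are bounded by \<open>c\<close>: a word bound of \<open>(n + m + 1) ^ c\<close> corresponds to words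
  of \<open>c * log\<^sub>2 (n + m + 1)\<close> bits.\<close>

definition computes_in_linear_time ::
    "program \<Rightarrow> nat \<Rightarrow> nat graph \<Rightarrow> nat list list \<Rightarrow> nat list option \<Rightarrow> bool" where
  "computes_in_linear_time A c G L res \<longleftrightarrow>
     (\<exists>t s. exec ((card (verts G) + card (edges G) + 1) ^ c) A (input_state L) t s \<and>
            t \<le> c * (card (verts G) + card (edges G)) \<and> result_of s = res)"

end

theory Submission
  imports Defs
begin

text \<open>
  If \<open>G\<close> is \<open>(P\<^sub>2 + 2P\<^sub>1)\<close>-free, then the common non-neighbours of the ends of an edge form a
  clique. Let \<open>v\<close> be a vertex of minimum degree. If \<open>d(x, y) \<ge> 4\<close>, then \<open>v\<close> is \<open>x\<close> or \<open>y\<close>: all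
  common non-neighbours of \<open>x\<close> and \<open>y\<close> are adjacent to \<open>N(x) \<union> N(y)\<close>, and \<open>N(x)\<close> and \<open>N(y)\<close> are
  cliques, so every other vertex has too large a degree. Hence a breadth-first search from \<open>v\<close> finds
  the diameter if it exceeds 3 or if \<open>v\<close> has eccentricity 3.

  Otherwise let \<open>d(x, y) = 3\<close>. Again by its degree, \<open>v\<close> lies, say, in \<open>N(x)\<close>, and \<open>x\<close> has a
  neighbour \<open>a\<close> outside \<open>N[v]\<close>, since \<open>v\<close> has a neighbour in \<open>N(y)\<close> besides \<open>x\<close>. For every such
  \<open>a\<close>, the vertex \<open>y\<close> is the only common non-neighbour of \<open>v\<close>, \<open>x\<close> and \<open>a\<close>: another one, \<open>z\<close>, would
  be adjacent to \<open>y\<close> because of the edge \<open>vx\<close>, and then \<open>yz\<close>, \<open>v\<close> and \<open>a\<close> would induce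
  \<open>P\<^sub>2 + 2P\<^sub>1\<close>. So each of the \<open>\<delta>\<close> neighbours \<open>w\<close> of \<open>v\<close> can be tested for the role of \<open>x\<close> in
  time \<open>O(n)\<close>, which is \<open>O(m)\<close> in total because \<open>n\<delta> \<le> 2m\<close>. A second search starts from a \<open>w\<close>
  that passes the test. The algorithm never rejects, as the result of a search is always a shortest
  path.
\<close>

section \<open>Distances in connected graphs\<close>

locale conn_graph =
  fixes G :: "'a graph"
  assumes simple: "simple_graph G" and connected: "connected_graph G"
begin

definition adj :: "'a \<Rightarrow> 'a \<Rightarrow> bool" where
  "adj u v \<longleftrightarrow> {u, v} \<in> edges G"

abbreviation dist :: "'a \<Rightarrow> 'a \<Rightarrow> nat" where
  "dist \<equiv> graph_dist G"

abbreviation nbrs :: "'a \<Rightarrow> 'a set" where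
  "nbrs v \<equiv> {u. adj v u}"

lemma finite_verts [simp]: "finite (verts G)"
  using simple by (simp add: simple_graph_def)

lemma adj_sym: "adj u v \<longleftrightarrow> adj v u"
  by (simp add: adj_def insert_commute)

lemma adj_verts: "adj u v \<Longrightarrow> u \<in> verts G \<and> v \<in> verts G \<and> u \<noteq> v"
proof -
  assume "adj u v"
  then obtain a b where "{u, v} = {a, b}" "a \<in> verts G" "b \<in> verts G" "a \<noteq> b"
    using simple unfolding simple_graph_def adj_def by blast
  then show ?thesis by (auto simp: doubleton_eq_iff)
qed

lemma adj_irrefl [simp]: "\<not> adj u u"
  using adj_verts by blast

lemma finite_nbrs [simp]: "finite (nbrs v)"
  by (rule finite_subset[OF _ finite_verts]) (use adj_verts in blast)

lemma dist_path:
  assumes "u \<in> verts G" "v \<in> verts G"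
  obtains p where "path_between G u p v" "length p = Suc (dist u v)"
proof -
  have "\<exists>k p. path_between G u p v \<and> length p - 1 = k"
    using connected assms by (auto simp: connected_graph_def)
  then have "\<exists>p. path_between G u p v \<and> length p - 1 = dist u v"
    unfolding graph_dist_def by (rule LeastI_ex)
  then obtain p where "path_between G u p v" "length p - 1 = dist u v" by blast
  moreover from this have "p \<noteq> []" by (simp add: path_between_def is_path_def)
  ultimately show ?thesis by (intro that[of p]) (auto simp: Suc_diff_Suc neq_Nil_conv)
qed

lemma dist_le: "path_between G u p v \<Longrightarrow> dist u v \<le> length p - 1"
  unfolding graph_dist_def by (rule Least_le) blast

lemma path_between_rev: "path_between G u p v \<Longrightarrow> path_between G v (rev p) u"
proof -
  assume p: "path_between G u p v"
  have "{rev p ! i, rev p ! Suc i} \<in> edges G" if "Suc i < length p" for i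
  proof -
    let ?j = "length p - Suc (Suc i)"
    have "Suc ?j < length p" "Suc ?j = length p - Suc i" using that by auto
    then have "{p ! ?j, p ! (length p - Suc i)} \<in> edges G"
      using p unfolding path_between_def is_path_def by metis
    then show ?thesis
      using that by (simp add: rev_nth insert_commute)
  qed
  with p show ?thesis
    by (auto simp: path_between_def is_path_def hd_rev last_rev)
qed

lemma dist_sym:
  assumes "u \<in> verts G" "v \<in> verts G"
  shows "dist u v = dist v u"
proof -
  have "dist b a \<le> dist a b" if "a \<in> verts G" "b \<in> verts G" for a b
    by (rule dist_path[OF that]) (use dist_le path_between_rev in fastforce)
  with assms show ?thesis by (simp add: le_antisym)
qed

lemma path_between_take:
  assumes "path_between G u p v" "k < length p"
  shows "path_between G u (take (Suc k) p) (p ! k)"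
  using assms
  by (auto simp: path_between_def is_path_def hd_conv_nth last_conv_nth dest: in_set_takeD)

text \<open>Paths must have distinct vertices, so a shortest path to \<open>v\<close> can be
  extended by \<open>w\<close> only if \<open>w\<close> is not on it; if it is, the prefix ending in
  \<open>w\<close> is short enough.\<close>

lemma dist_step:
  assumes u: "u \<in> verts G" and e: "adj v w"
  shows "dist u w \<le> Suc (dist u v)"
proof -
  have vw: "v \<in> verts G" "w \<in> verts G" using adj_verts[OF e] by auto
  obtain p where p: "path_between G u p v" "length p = Suc (dist u v)"
    using dist_path[OF u vw(1)] .
  show ?thesis
  proof (cases "w \<in> set p")
    case True
    then obtain k where k: "k < length p" "p ! k = w" by (auto simp: in_set_conv_nth)
    have "dist u w \<le> k"
      using dist_le[OF path_between_take[OF p(1) k(1)]] k by simp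
    with k(1) p(2) show ?thesis by simp
  next
    case False
    have "{(p @ [w]) ! i, (p @ [w]) ! Suc i} \<in> edges G" if "Suc i < Suc (length p)" for i
    proof (cases "Suc i < length p")
      case True
      then show ?thesis using p(1) by (simp add: path_between_def is_path_def nth_append)
    next
      case False
      then have "Suc i = length p" using that by simp
      moreover have "p ! i = v"
        using p(1) calculation by (metis diff_Suc_1 last_conv_nth length_0_conv nat.distinct(1) path_between_def)
      ultimately show ?thesis using e by (simp add: nth_append adj_def)
    qed
    then have "path_between G u (p @ [w]) w"
      using p(1) False vw by (auto simp: path_between_def is_path_def)
    from dist_le[OF this] p(2) show ?thesis by simp
  qed
qed

lemma dist_0_iff:
  assumes "u \<in> verts G" "v \<in> verts G"
  shows "dist u v = 0 \<longleftrightarrow> u = v"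
proof
  assume "dist u v = 0"
  with dist_path[OF assms] obtain p where "path_between G u p v" "length p = 1" by auto
  then show "u = v" by (cases p) (auto simp: path_between_def)
next
  assume "u = v"
  then have "path_between G u [u] v" using assms by (simp add: path_between_def is_path_def)
  from dist_le[OF this] show "dist u v = 0" by simp
qed

text \<open>The last but one vertex of a shortest path: the prefix ending there gives
  \<open>\<le> k\<close>, and \<open>dist_step\<close> gives the converse. All inductions on the
  distance go through this lemma.\<close>

lemma dist_pred:
  assumes u: "u \<in> verts G" and w: "w \<in> verts G" and k: "dist u w = Suc k"
  obtains v where "adj v w" "dist u v = k"
proof -
  obtain p where p: "path_between G u p w" "length p = Suc (Suc k)"
    using dist_path[OF u w] k by metis
  have "p ! Suc k = w"
    using p by (metis diff_Suc_1 last_conv_nth length_0_conv nat.distinct(1) path_between_def)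
  then have e: "adj (p ! k) w"
    using p by (auto simp: path_between_def is_path_def adj_def)
  have "dist u (p ! k) \<le> k"
    using dist_le[OF path_between_take[OF p(1), of k]] p(2) by simp
  with dist_step[OF u e] k e show ?thesis by (intro that[of "p ! k"]) auto
qed

text \<open>A path repeats no vertex. This bound keeps stored distances within a machine
  word.\<close>

lemma dist_less_card:
  assumes "u \<in> verts G" "v \<in> verts G"
  shows "dist u v < card (verts G)"
proof -
  obtain p where p: "path_between G u p v" "length p = Suc (dist u v)"
    using dist_path[OF assms] .
  then have c: "card (set p) = Suc (dist u v)" "set p \<subseteq> verts G"
    by (auto simp: path_between_def is_path_def distinct_card)
  from card_mono[OF finite_verts c(2)] c(1) show ?thesis by simp
qed

lemma diam_eqI:
  assumes "x \<in> verts G" "y \<in> verts G"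
    and "\<And>u v. u \<in> verts G \<Longrightarrow> v \<in> verts G \<Longrightarrow> dist u v \<le> dist x y"
  shows "diam G = dist x y"
proof -
  have "{dist u v |u v. u \<in> verts G \<and> v \<in> verts G} =
      (\<lambda>(u, v). dist u v) ` (verts G \<times> verts G)" by auto
  then show ?thesis
    unfolding diam_def by (intro Max_eqI) (use assms in auto)
qed

text \<open>The distance to \<open>u\<close> drops by one in each step and ends at 0, so it equals
  the number of remaining edges. Hence the vertices are distinct and the length is the distance.
  This is how chains of parents become shortest paths.\<close>

lemma descending_path:
  assumes "u \<in> verts G" "p \<noteq> []" "set p \<subseteq> verts G" "last p = u"
    and step: "\<And>i. Suc i < length p \<Longrightarrow> adj (p ! i) (p ! Suc i) \<and> dist u (p ! i) = Suc (dist u (p ! Suc i))"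
  shows "shortest_path G p"
proof -
  have len: "length p = Suc (length p - 1)" using assms(2) by simp
  \<comment> \<open>Positions are counted from the end of \<open>p\<close>, where the distance is
    known to be 0.\<close>
  have d: "dist u (p ! (length p - 1 - k)) = k" if "k < length p" for k
    using that
  proof (induction k)
    case 0
    then show ?case using assms dist_0_iff[of u u] by (simp add: last_conv_nth)
  next
    case (Suc k)
    then have "Suc (length p - 1 - Suc k) = length p - 1 - k" by simp
    with step[of "length p - 1 - Suc k"] Suc show ?case by simp
  qed
  have d': "dist u (p ! i) = length p - 1 - i" if "i < length p" for i
    using d[of "length p - 1 - i"] that by simp
  have "distinct p"
    unfolding distinct_conv_nth
  proof (intro allI impI)
    fix i j assume "i < length p" "j < length p" "i \<noteq> j"
    with d'[of i] d'[of j] show "p ! i \<noteq> p ! j" by auto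
  qed
  then have "is_path G p" using assms step by (auto simp: is_path_def adj_def)
  moreover have "hd p \<in> verts G" using assms by auto
  ultimately show ?thesis
    using d'[of 0] assms dist_sym[of u "hd p"] by (auto simp: shortest_path_def hd_conv_nth)
qed

section \<open>Diametral pairs and vertices of minimum degree\<close>

text \<open>Otherwise \<open>u\<close>, \<open>v\<close>, \<open>s\<close>, \<open>t\<close> induce
  \<open>P2_plus_2P1\<close>. Freeness is used only in this form: two vertices with no contact to an
  edge are adjacent.\<close>

lemma free_imp_adj:
  assumes "free_of G P2_plus_2P1" and e: "adj u v" and st: "s \<in> verts G" "t \<in> verts G" "s \<noteq> t"
    and d: "s \<noteq> u" "s \<noteq> v" "t \<noteq> u" "t \<noteq> v"
    and n: "\<not> adj u s" "\<not> adj u t" "\<not> adj v s" "\<not> adj v t"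
  shows "adj s t"
proof (rule ccontr)
  assume nst: "\<not> adj s t"
  let ?S = "{u, v, s, t}"
  let ?f = "\<lambda>x. if x = u then Inl 0 else if x = v then Inl 1
     else if x = s then Inr (Inl 0) else Inr (Inr 0) :: nat + (nat + nat)"
  have uv: "u \<in> verts G" "v \<in> verts G" "u \<noteq> v" using adj_verts[OF e] by auto
  have V: "verts P2_plus_2P1 = {Inl 0, Inl 1, Inr (Inl 0), Inr (Inr 0)}"
    by (auto simp: P2_plus_2P1_def disjoint_union_def path_graph_def)
  have E: "edges P2_plus_2P1 = {{Inl 0, Inl 1}}"
  proof -
    have "{{i, Suc i} |i. Suc i < 2} = {{0, 1 :: nat}}" by (auto simp: less_Suc_eq)
    then show ?thesis by (simp add: P2_plus_2P1_def disjoint_union_def path_graph_def)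
  qed
  have "bij_betw ?f ?S (verts P2_plus_2P1)"
    unfolding V bij_betw_def inj_on_def using d st uv by auto
  moreover have "{x, y} \<in> edges (induced_subgraph G ?S) \<longleftrightarrow> {?f x, ?f y} \<in> edges P2_plus_2P1"
    if "x \<in> ?S" "y \<in> ?S" for x y
  proof -
    have "{x, y} \<in> edges (induced_subgraph G ?S) \<longleftrightarrow> adj x y"
      using that by (auto simp: induced_subgraph_def adj_def)
    also have "\<dots> \<longleftrightarrow> {x, y} = {u, v}"
      using that e n nst adj_sym adj_irrefl d st uv by (auto simp: doubleton_eq_iff)
    also have "\<dots> \<longleftrightarrow> {?f x, ?f y} = {Inl 0, Inl 1}"
      using that d st uv by (auto simp: doubleton_eq_iff)
    finally show ?thesis unfolding E by simp
  qed
  moreover have "verts (induced_subgraph G ?S) = ?S" by (simp add: induced_subgraph_def)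
  moreover have "?S \<subseteq> verts G" using uv st by simp
  ultimately have "\<not> free_of G P2_plus_2P1"
    unfolding free_of_def isomorphic_def by (auto intro!: exI[of _ ?S] exI[of _ ?f])
  with assms(1) show False by simp
qed

text \<open>Translates distances into adjacency, which is the language of
  \<open>free_imp_adj\<close> and of the test performed by the program.\<close>

lemma dist_ge_3:
  assumes "x \<in> verts G" "y \<in> verts G"
  shows "3 \<le> dist x y \<longleftrightarrow> x \<noteq> y \<and> \<not> adj x y \<and> (\<forall>z. adj x z \<longrightarrow> \<not> adj z y)"
proof -
  have x0: "dist x x = 0" using dist_0_iff assms by simp
  show ?thesis
  proof (intro iffI conjI allI impI notI)
    assume d: "3 \<le> dist x y"
    show False if "x = y" using that d x0 by simp
    show False if "adj x y" using dist_step[OF assms(1) that] d x0 by simp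
    show False if "adj x z" "adj z y" for z
      using dist_step[OF assms(1) that(1)] dist_step[OF assms(1) that(2)] d x0 by simp
  next
    assume a: "x \<noteq> y \<and> \<not> adj x y \<and> (\<forall>z. adj x z \<longrightarrow> \<not> adj z y)"
    show "3 \<le> dist x y"
    proof (rule ccontr)
      assume "\<not> 3 \<le> dist x y"
      moreover have "dist x y \<noteq> 0" using a dist_0_iff assms by simp
      ultimately consider "dist x y = Suc 0" | "dist x y = Suc (Suc 0)" by linarith
      then show False
      proof cases
        case 1
        then obtain v where "adj v y" "dist x v = 0" by (rule dist_pred[OF assms])
        with a show False using dist_0_iff assms adj_verts by metis
      next
        case 2
        then obtain v where v: "adj v y" "dist x v = Suc 0" by (rule dist_pred[OF assms])
        then obtain w where "adj w v" "dist x w = 0" using dist_pred assms adj_verts by metis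
        then have "adj x v" using dist_0_iff assms adj_verts by metis
        with v a show False by blast
      qed
    qed
  qed
qed

lemma has_nbr:
  assumes "x \<in> verts G" "y \<in> verts G" "x \<noteq> y"
  obtains a where "adj y a"
proof -
  obtain k where "dist x y = Suc k"
    using dist_0_iff[OF assms(1,2)] assms(3) by (cases "dist x y") auto
  then obtain a where "adj a y" by (rule dist_pred[OF assms(1,2)])
  then show ?thesis using adj_sym that by blast
qed

definition min_degree_vertex :: "'a \<Rightarrow> bool" where
  "min_degree_vertex v \<longleftrightarrow> v \<in> verts G \<and> (\<forall>u\<in>verts G. card (nbrs v) \<le> card (nbrs u))"

text \<open>If a neighbour \<open>a\<close> of \<open>x\<close> were not adjacent to
  \<open>c\<close>, the edge \<open>xa\<close> would have no contact with \<open>y\<close> and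
  \<open>c\<close>, which would force \<open>y\<close> and \<open>c\<close> to be adjacent.\<close>

lemma far_pair_common_nonnbr:
  assumes free: "free_of G P2_plus_2P1" and xy: "x \<in> verts G" "y \<in> verts G" "3 \<le> dist x y"
    and c: "c \<in> verts G" "c \<noteq> x" "c \<noteq> y" "\<not> adj x c" "\<not> adj y c"
  shows "nbrs x \<subseteq> nbrs c"
proof (clarify, rule ccontr)
  fix a assume a: "adj x a" "\<not> adj c a"
  note far = dist_ge_3[OF xy(1,2), THEN iffD1, OF xy(3)]
  have "adj y c"
    by (rule free_imp_adj[OF free a(1)]) (use a c xy far adj_sym in auto)
  with c show False by simp
qed

text \<open>Otherwise \<open>v\<close> is adjacent to all of \<open>N(x)\<close> and
  \<open>N(y)\<close>. These sets are disjoint and \<open>N(y)\<close> is nonempty, so the degree of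
  \<open>v\<close> exceeds that of \<open>x\<close>.\<close>

lemma min_degree_near_far_pair:
  assumes free: "free_of G P2_plus_2P1" and v: "min_degree_vertex v"
    and xy: "x \<in> verts G" "y \<in> verts G" "3 \<le> dist x y"
  shows "v \<in> {x, y} \<or> adj x v \<or> adj y v"
proof (rule ccontr)
  assume "\<not> ?thesis"
  then have c: "v \<noteq> x" "v \<noteq> y" "\<not> adj x v" "\<not> adj y v" by auto
  have vV: "v \<in> verts G" using v by (simp add: min_degree_vertex_def)
  note far = dist_ge_3[OF xy(1,2), THEN iffD1, OF xy(3)]
  have "nbrs x \<union> nbrs y \<subseteq> nbrs v"
    using far_pair_common_nonnbr[OF free xy vV] far_pair_common_nonnbr[OF free xy(2,1) _ vV]
      c xy dist_sym by auto
  then have "card (nbrs x \<union> nbrs y) \<le> card (nbrs v)" by (intro card_mono) auto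
  moreover have "card (nbrs x \<union> nbrs y) = card (nbrs x) + card (nbrs y)"
    using far adj_sym[of _ y] by (intro card_Un_disjoint) auto
  moreover obtain b where "adj y b" using has_nbr[OF xy(1,2)] far by blast
  then have "card (nbrs y) > 0" by (auto simp: card_gt_0_iff)
  ultimately show False using v xy by (fastforce simp: min_degree_vertex_def)
qed

lemma min_degree_dist_4:
  assumes free: "free_of G P2_plus_2P1" and v: "min_degree_vertex v"
    and xy: "x \<in> verts G" "y \<in> verts G" "4 \<le> dist x y"
  shows "v \<in> {x, y}"
proof -
  \<comment> \<open>By \<open>min_degree_near_far_pair\<close> it remains to exclude that
    \<open>v\<close> is a neighbour of \<open>x\<close> or of \<open>y\<close>; the claim is applied
    to both orders of the pair.\<close>
  have nadj: "\<not> adj x v" if xy: "x \<in> verts G" "y \<in> verts G" "4 \<le> dist x y" for x y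
  proof
    assume a: "adj x v"
    have x0: "dist x x = 0" using dist_0_iff xy by simp
    note far = dist_ge_3[OF xy(1,2), THEN iffD1]
    have no_edge: "\<not> adj p q" if "adj x p" "adj y q" for p q
      using that xy x0 dist_step[OF xy(1), of x p] dist_step[OF xy(1), of p q]
        dist_step[OF xy(1), of q y] adj_sym[of y q] by fastforce
    have ne: "x \<noteq> y" using x0 xy by auto
    obtain b where b: "adj y b" using has_nbr[OF xy(1,2) ne] .
    have no: "\<not> adj b q" "\<not> adj y q" "q \<noteq> y" "q \<noteq> b" "q \<in> verts G" if "adj x q" for q
      using that far xy b no_edge[OF that b] adj_sym adj_verts by (fastforce simp del: adj_irrefl)+
    \<comment> \<open>At distance 4 or more, the edge \<open>yb\<close> has no contact with
      \<open>N(x)\<close>, so \<open>N(x)\<close> is a clique.\<close>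
    have clique: "adj p v" if p: "adj x p" "p \<noteq> v" for p
      by (rule free_imp_adj[OF free b]) (use p no[OF p(1)] no[OF a] in auto)
    \<comment> \<open>Walking back from \<open>y\<close> along predecessors reaches a vertex at
      distance 2 from \<open>x\<close>. It is a common non-neighbour of \<open>x\<close> and
      \<open>y\<close>, hence adjacent to all of \<open>N(x)\<close>, in particular to
      \<open>v\<close>.\<close>
    obtain c where c: "dist x c = 2" "c \<in> verts G"
    proof -
      have "\<exists>c\<in>verts G. dist x c = dist x y - k" if "k \<le> dist x y" for k
        using that
      proof (induction k)
        case 0
        then show ?case using xy by auto
      next
        case (Suc k)
        then obtain c where "c \<in> verts G" "dist x c = Suc (dist x y - Suc k)" by force
        then show ?case using dist_pred[OF xy(1)] adj_verts by metis
      qed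
      from this[of "dist x y - 2"] show ?thesis using xy that by auto
    qed
    have cx: "c \<noteq> x" "c \<noteq> y" "\<not> adj x c" "\<not> adj y c"
      using c x0 xy dist_step[OF xy(1), of x c] dist_step[OF xy(1), of c y] adj_sym by fastforce+
    have "nbrs x \<subseteq> nbrs c"
      by (rule far_pair_common_nonnbr[OF free xy(1,2) _ c(2)]) (use xy cx in auto)
    then have vc: "adj v c" using a adj_sym by auto
    \<comment> \<open>Compared with \<open>N(x)\<close>, the vertex \<open>v\<close> is lost but
      \<open>x\<close> and \<open>c\<close> are gained, so \<open>v\<close> has larger degree than
      \<open>x\<close>.\<close>
    have "insert x (insert c (nbrs x - {v})) \<subseteq> nbrs v"
      using vc a clique adj_sym by auto
    then have "card (insert x (insert c (nbrs x - {v}))) \<le> card (nbrs v)" by (intro card_mono) auto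
    moreover have "card (insert x (insert c (nbrs x - {v}))) = Suc (card (nbrs x))"
      using cx a card_Suc_Diff1[of "nbrs x" v] by simp
    ultimately show False using v xy by (fastforce simp: min_degree_vertex_def)
  qed
  show ?thesis
    using min_degree_near_far_pair[OF free v xy(1,2)] xy nadj[OF xy] nadj[OF xy(2,1)] dist_sym
    by auto
qed

lemma min_degree_dist_3:
  assumes free: "free_of G P2_plus_2P1" and v: "min_degree_vertex v"
    and near: "\<And>z. z \<in> verts G \<Longrightarrow> dist v z < 3"
    and xy: "x \<in> verts G" "y \<in> verts G" "3 \<le> dist x y"
  obtains w y' where "adj v w" "y' \<in> verts G" "3 \<le> dist w y'"
    "\<exists>a. adj w a \<and> \<not> adj v a \<and> a \<noteq> v"
    "\<And>a z. adj w a \<Longrightarrow> \<not> adj v a \<Longrightarrow> a \<noteq> v \<Longrightarrow> z \<in> verts G \<Longrightarrow>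
       \<not> adj v z \<Longrightarrow> \<not> adj w z \<Longrightarrow> \<not> adj a z \<Longrightarrow> z = y'"
proof -
  have vV: "v \<in> verts G" using v by (simp add: min_degree_vertex_def)
  \<comment> \<open>All distances from \<open>v\<close> are below 3, so \<open>v\<close> is neither
    end of the pair. It is a neighbour of one end, which is called \<open>x\<close> from here
    on.\<close>
  have "\<exists>x y. x \<in> verts G \<and> y \<in> verts G \<and> 3 \<le> dist x y \<and> adj x v"
    using min_degree_near_far_pair[OF free v xy] near[of y] near[of x] xy
      dist_sym[OF xy(1,2)] dist_sym[OF xy(1) vV] by (metis insertE linorder_not_less singletonD)
  then obtain x y where xy: "x \<in> verts G" "y \<in> verts G" "3 \<le> dist x y" and xv: "adj x v" by blast
  note far = dist_ge_3[OF xy(1,2), THEN iffD1, OF xy(3)]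
  obtain b where b: "adj v b" "adj b y"
    using near[OF xy(2)] dist_ge_3[OF vV xy(2)] far xv adj_sym by (metis linorder_not_less)
  show ?thesis
  proof (rule that[of x y])
    show "adj v x" using xv adj_sym by simp
    show "\<exists>a. adj x a \<and> \<not> adj v a \<and> a \<noteq> v"
    proof (rule ccontr)
      assume "\<not> ?thesis"
      \<comment> \<open>If \<open>N(x)\<close> lay within \<open>N[v]\<close>, then \<open>v\<close>
        would be adjacent to \<open>x\<close>, to \<open>b\<close> and to all of \<open>N(x)\<close>
        except itself, again more than the degree of \<open>x\<close>.\<close>
      then have "insert x (insert b (nbrs x - {v})) \<subseteq> nbrs v" using xv b adj_sym by auto
      then have "card (insert x (insert b (nbrs x - {v}))) \<le> card (nbrs v)" by (intro card_mono) auto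
      moreover have "b \<noteq> x" "\<not> adj x b" using b far adj_sym by auto
      then have "card (insert x (insert b (nbrs x - {v}))) = Suc (card (nbrs x))"
        using xv card_Suc_Diff1[of "nbrs x" v] by simp
      ultimately show False using v xy by (fastforce simp: min_degree_vertex_def)
    qed
    fix a z
    assume a: "adj x a" "\<not> adj v a" "a \<noteq> v"
      and z: "z \<in> verts G" "\<not> adj v z" "\<not> adj x z" "\<not> adj a z"
    have *: "z \<noteq> x" "z \<noteq> v" "z \<noteq> a" using z xv a adj_sym by auto
    show "z = y"
    proof (rule ccontr)
      assume "z \<noteq> y"
      \<comment> \<open>The edge \<open>xv\<close> has no contact with \<open>y\<close> and
        \<open>z\<close>, so these are adjacent. Then the edge \<open>yz\<close> has no contact with
        \<open>v\<close> and \<open>a\<close>, which contradicts the choice of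
        \<open>a\<close>.\<close>
      then have "adj y z"
        by (intro free_imp_adj[OF free xv]) (use z a xy far xv adj_sym * in auto)
      then have "adj v a"
        by (rule free_imp_adj[OF free])
          (use z a xy far xv adj_sym * vV adj_verts[OF a(1)] in auto)
      with a show False by simp
    qed
  qed (use xy in auto)
qed

end

section \<open>Time-bounded total correctness\<close>

text \<open>Total correctness: an execution exists, so the program halts within \<open>T\<close> and
  no instruction is stuck at the word bound.\<close>

definition runs :: "nat \<Rightarrow> program \<Rightarrow> state \<Rightarrow> nat \<Rightarrow> (state \<Rightarrow> bool) \<Rightarrow> bool" where
  "runs W c s T Q \<longleftrightarrow> (\<exists>t s'. exec W c s t s' \<and> t \<le> T \<and> Q s')"

lemma runs_mono:
  "runs W c s T Q \<Longrightarrow> T \<le> T' \<Longrightarrow> (\<And>s'. Q s' \<Longrightarrow> Q' s') \<Longrightarrow> runs W c s T' Q'"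
  unfolding runs_def by (meson le_trans)

lemma runs_Skip [simp]: "runs W Skip s T Q \<longleftrightarrow> 1 \<le> T \<and> Q s"
  by (fastforce simp: runs_def intro: exec.Skip elim: exec.cases)

lemma runs_Assign [simp]:
  "runs W (Assign x r) s T Q \<longleftrightarrow> 1 \<le> T \<and> rhs_val r s \<le> W \<and> Q (set_scalar x (rhs_val r s) s)"
  by (fastforce simp: runs_def intro: exec.Assign elim: exec.cases)

lemma runs_Write [simp]:
  "runs W (Write A i a) s T Q \<longleftrightarrow> 1 \<le> T \<and> operand_val i s \<le> W \<and> operand_val a s \<le> W \<and>
     Q (set_array A (operand_val i s) (operand_val a s) s)"
  by (fastforce simp: runs_def intro: exec.Write elim: exec.cases)

lemma runs_If [simp]:
  "runs W (If b c1 c2) s T Q \<longleftrightarrow>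
     1 \<le> T \<and> (if test_val b s then runs W c1 s (T - 1) Q else runs W c2 s (T - 1) Q)"
proof
  assume "runs W (If b c1 c2) s T Q"
  then show "1 \<le> T \<and> (if test_val b s then runs W c1 s (T - 1) Q else runs W c2 s (T - 1) Q)"
    unfolding runs_def by (fastforce elim: exec.cases[of W "If b c1 c2"])
next
  assume *: "1 \<le> T \<and> (if test_val b s then runs W c1 s (T - 1) Q else runs W c2 s (T - 1) Q)"
  then obtain t s' where "exec W (if test_val b s then c1 else c2) s t s'" "t \<le> T - 1" "Q s'"
    by (auto simp: runs_def split: if_splits)
  with * have "exec W (If b c1 c2) s (Suc t) s'" "Suc t \<le> T" "Q s'"
    by (auto intro: exec.IfTrue[simplified] exec.IfFalse[simplified] split: if_splits)
  then show "runs W (If b c1 c2) s T Q" unfolding runs_def by blast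
qed

lemma runs_Seq:
  assumes "runs W c1 s T1 (\<lambda>s1. runs W c2 s1 T2 Q)" "T1 + T2 \<le> T"
  shows "runs W (Seq c1 c2) s T Q"
proof -
  obtain t1 s1 t2 s2 where "exec W c1 s t1 s1" "t1 \<le> T1" "exec W c2 s1 t2 s2" "t2 \<le> T2" "Q s2"
    using assms(1) by (auto simp: runs_def)
  moreover from this have "t1 + t2 \<le> T" using assms(2) by linarith
  ultimately show ?thesis unfolding runs_def by (blast intro: exec.Seq)
qed

lemma runs_SeqI:
  assumes "runs W c s T P" "\<And>s'. P s' \<Longrightarrow> runs W c' s' U Q" "T + U \<le> T'"
  shows "runs W (Seq c c') s T' Q"
  by (rule runs_Seq[OF runs_mono[OF assms(1) order_refl assms(2)] assms(3)])

text \<open>For a general sequence the time bound has to be split by hand; an instruction costs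
  exactly 1, so the split is forced and an equivalence holds. With such rules the simplifier
  executes loop-free code symbolically.\<close>

lemma runs_Seq_Assign [simp]:
  "runs W (Seq (Assign x r) c) s T Q \<longleftrightarrow>
     1 \<le> T \<and> rhs_val r s \<le> W \<and> runs W c (set_scalar x (rhs_val r s) s) (T - 1) Q"
proof
  assume "runs W (Seq (Assign x r) c) s T Q"
  then obtain t s' where "exec W (Seq (Assign x r) c) s t s'" "t \<le> T" "Q s'"
    by (auto simp: runs_def)
  then show "1 \<le> T \<and> rhs_val r s \<le> W \<and> runs W c (set_scalar x (rhs_val r s) s) (T - 1) Q"
    by (auto simp: runs_def elim!: exec.cases[of W "Seq _ _"] exec.cases[of W "Assign _ _"]
      intro!: exI[of _ "t - 1"])
next
  assume "1 \<le> T \<and> rhs_val r s \<le> W \<and> runs W c (set_scalar x (rhs_val r s) s) (T - 1) Q"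
  then show "runs W (Seq (Assign x r) c) s T Q"
    by (intro runs_Seq[of _ _ _ 1 _ "T - 1"]) auto
qed

lemma runs_Seq_Write [simp]:
  "runs W (Seq (Write A i a) c) s T Q \<longleftrightarrow>
     1 \<le> T \<and> operand_val i s \<le> W \<and> operand_val a s \<le> W \<and>
     runs W c (set_array A (operand_val i s) (operand_val a s) s) (T - 1) Q"
proof
  assume "runs W (Seq (Write A i a) c) s T Q"
  then obtain t s' where "exec W (Seq (Write A i a) c) s t s'" "t \<le> T" "Q s'"
    by (auto simp: runs_def)
  then show "1 \<le> T \<and> operand_val i s \<le> W \<and> operand_val a s \<le> W \<and>
     runs W c (set_array A (operand_val i s) (operand_val a s) s) (T - 1) Q"
    by (auto simp: runs_def elim!: exec.cases[of W "Seq _ _"] exec.cases[of W "Write _ _ _"]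
      intro!: exI[of _ "t - 1"])
next
  assume "1 \<le> T \<and> operand_val i s \<le> W \<and> operand_val a s \<le> W \<and>
     runs W c (set_array A (operand_val i s) (operand_val a s) s) (T - 1) Q"
  then show "runs W (Seq (Write A i a) c) s T Q"
    by (intro runs_Seq[of _ _ _ 1 _ "T - 1"]) auto
qed

text \<open>\<open>V\<close> is a potential that pays for the body and for one test in each
  iteration; the extra 1 is the failing test. The cost \<open>T\<close> of the body may depend on
  the state, which allows amortised bounds.\<close>

lemma runs_While:
  assumes "I s"
    and body: "\<And>s. I s \<Longrightarrow> test_val b s \<Longrightarrow> \<exists>T. runs W c s T (\<lambda>s'. I s' \<and> T + 1 + V s' \<le> V s)"
    and post: "\<And>s. I s \<Longrightarrow> \<not> test_val b s \<Longrightarrow> Q s"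
    and T: "V s + 1 \<le> T"
  shows "runs W (While b c) s T Q"
proof -
  have "\<exists>t s'. exec W (While b c) s t s' \<and> t \<le> V s + 1 \<and> Q s'"
    using assms(1)
  proof (induction "V s" arbitrary: s rule: less_induct)
    case less
    show ?case
    proof (cases "test_val b s")
      case False
      then show ?thesis using less.prems post by (force intro: exec.WhileFalse)
    next
      case True
      obtain T t1 s1 where 1: "exec W c s t1 s1" "t1 \<le> T" "I s1" "T + 1 + V s1 \<le> V s"
        using body[OF less.prems True] by (auto simp: runs_def)
      then obtain t2 s2 where 2: "exec W (While b c) s1 t2 s2" "t2 \<le> V s1 + 1" "Q s2"
        using less.hyps[of s1] by auto
      have "exec W (While b c) s (1 + t1 + t2) s2"
        using True 1(1) 2(1) by (rule exec.WhileTrue)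
      moreover have "1 + t1 + t2 \<le> V s + 1" using 1 2 by linarith
      ultimately show ?thesis using 2(3) by blast
    qed
  qed
  then show ?thesis unfolding runs_def using T le_trans by blast
qed

lemma scalar_set_scalar [simp]: "scalar (set_scalar x v s) = (scalar s)(x := v)"
  by (simp add: set_scalar_def)

lemma array_set_scalar [simp]: "array (set_scalar x v s) = array s"
  by (simp add: set_scalar_def)

lemma scalar_set_array [simp]: "scalar (set_array A i v s) = scalar s"
  by (simp add: set_array_def)

lemma array_set_array [simp]:
  "array (set_array A i v s) = (array s)(A := (array s A)(i := v))"
  by (simp add: set_array_def)

text \<open>A frame condition: \<open>X\<close> and \<open>Y\<close> list the scalars and arrays
  that a program is allowed to change.\<close>

definition changes_only :: "name set \<Rightarrow> name set \<Rightarrow> state \<Rightarrow> state \<Rightarrow> bool" where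
  "changes_only X Y s s' \<longleftrightarrow>
     (\<forall>x. x \<notin> X \<longrightarrow> scalar s' x = scalar s x) \<and> (\<forall>A. A \<notin> Y \<longrightarrow> array s' A = array s A)"

lemma changes_only_refl [simp]: "changes_only X Y s s"
  by (simp add: changes_only_def)

lemma changes_only_trans:
  "changes_only X Y s s' \<Longrightarrow> changes_only X' Y' s' s'' \<Longrightarrow> X' \<subseteq> X \<Longrightarrow> Y' \<subseteq> Y \<Longrightarrow>
     changes_only X Y s s''"
  unfolding changes_only_def by (metis subsetD)

lemma changes_only_set_scalar [simp]:
  "x \<in> X \<Longrightarrow> changes_only X Y s s' \<Longrightarrow> changes_only X Y s (set_scalar x v s')"
  by (auto simp: changes_only_def)

lemma changes_only_set_array [simp]:
  "A \<in> Y \<Longrightarrow> changes_only X Y s s' \<Longrightarrow> changes_only X Y s (set_array A i v s')"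
  by (auto simp: changes_only_def)

lemma changes_only_scalar: "changes_only X Y s s' \<Longrightarrow> x \<notin> X \<Longrightarrow> scalar s' x = scalar s x"
  by (simp add: changes_only_def)

lemma changes_only_array: "changes_only X Y s s' \<Longrightarrow> A \<notin> Y \<Longrightarrow> array s' A = array s A"
  by (simp add: changes_only_def)

section \<open>Loops over vertices and over neighbours\<close>

definition for_verts :: "name \<Rightarrow> program \<Rightarrow> program" where
  "for_verts u body =
     Seq (Assign u (Opd (Const 0)))
     (While (Less (Var u) (Var ''n''))
       (Seq body (Assign u (Add (Var u) (Const 1)))))"

text \<open>Addresses are scalars or constants, so \<open>j\<close> holds \<open>v + 1\<close>
  before it receives the end of the block.\<close>

definition for_nbrs :: "name \<Rightarrow> name \<Rightarrow> name \<Rightarrow> name \<Rightarrow> program \<Rightarrow> program" where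
  "for_nbrs i j u v body =
     Seq (Assign i (Read ''off'' (Var v)))
     (Seq (Assign j (Add (Var v) (Const 1)))
     (Seq (Assign j (Read ''off'' (Var j)))
     (While (Less (Var i) (Var j))
       (Seq (Assign u (Read ''adj'' (Var i)))
       (Seq body (Assign i (Add (Var i) (Const 1))))))))"

text \<open>\<open>W\<close> is any number above a linear bound that covers vertices, positions,
  marks and incremented counters. The polynomial word bound of the model enters only at the final
  interpretation.\<close>

locale input = conn_graph G for G :: "nat graph" +
  fixes L :: "nat list list" and W :: nat
  assumes lists: "adjacency_lists G L"
    and W: "length L + length (concat L) + 2 \<le> W"
begin

abbreviation n :: nat where "n \<equiv> length L"

abbreviation deg :: "nat \<Rightarrow> nat" where "deg v \<equiv> length (L ! v)"

definition offset :: "nat \<Rightarrow> nat" where "offset v = length (concat (take v L))"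

text \<open>The invariant of all phases: the input is intact, and \<open>reject\<close> is still 0,
  so that the result is a path.\<close>

definition ready :: "state \<Rightarrow> bool" where
  "ready s \<longleftrightarrow> scalar s ''n'' = n \<and> scalar s ''reject'' = 0 \<and>
     array s ''off'' = array (input_state L) ''off'' \<and>
     array s ''adj'' = array (input_state L) ''adj''"

lemma ready_input: "ready (input_state L)"
  by (simp add: ready_def input_state_def)

lemma ready_set_scalar [simp]:
  "x \<noteq> ''n'' \<Longrightarrow> x \<noteq> ''reject'' \<Longrightarrow> ready (set_scalar x v s) \<longleftrightarrow> ready s"
  by (simp add: ready_def)

lemma ready_set_array [simp]:
  "A \<noteq> ''off'' \<Longrightarrow> A \<noteq> ''adj'' \<Longrightarrow> ready (set_array A i v s) \<longleftrightarrow> ready s"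
  by (simp add: ready_def)

lemma verts_eq: "verts G = {..<n}"
  using lists by (auto simp: adjacency_lists_def)

lemma set_L: "v < n \<Longrightarrow> set (L ! v) = nbrs v"
  using lists by (auto simp: adjacency_lists_def adj_def)

lemma deg_eq: "v < n \<Longrightarrow> deg v = card (nbrs v)"
  using lists set_L distinct_card by (metis adjacency_lists_def)

lemma adj_less: "adj u v \<Longrightarrow> u < n \<and> v < n"
  using adj_verts by (simp add: verts_eq)

lemma nth_L: "v < n \<Longrightarrow> k < deg v \<Longrightarrow> adj v (L ! v ! k)"
  using set_L nth_mem by blast

lemma offset_Suc: "v < n \<Longrightarrow> offset (Suc v) = offset v + deg v"
  by (simp add: offset_def take_Suc_conv_app_nth)

lemma offset_le: "offset v \<le> length (concat L)"
proof -
  have "concat L = concat (take v L) @ concat (drop v L)" by (metis append_take_drop_id concat_append)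
  then show ?thesis by (simp add: offset_def)
qed

lemma concat_nth: "v < n \<Longrightarrow> k < deg v \<Longrightarrow> concat L ! (offset v + k) = L ! v ! k"
proof -
  assume v: "v < n" and k: "k < deg v"
  have "concat L = concat (take v L) @ L ! v @ concat (drop (Suc v) L)"
    using v by (metis append_take_drop_id concat_append concat.simps(2) Cons_nth_drop_Suc)
  then show ?thesis using k by (simp add: offset_def nth_append)
qed

lemma ready_off: "ready s \<Longrightarrow> v \<le> n \<Longrightarrow> array s ''off'' v = offset v"
  by (simp add: ready_def input_state_def offset_def)

lemma ready_adj:
  "ready s \<Longrightarrow> v < n \<Longrightarrow> k < deg v \<Longrightarrow> array s ''adj'' (offset v + k) = L ! v ! k"
  using concat_nth offset_Suc[of v] offset_le[of "Suc v"]
  by (simp add: ready_def input_state_def)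

lemma n_pos: "0 < n"
  using connected by (auto simp: connected_graph_def verts_eq)

text \<open>\<open>J k\<close> describes the state before the body is run for vertex
  \<open>k\<close>. Besides \<open>K\<close>, each round pays for the increment and the test; the
  constant 2 is the initialisation and the last test.\<close>

lemma runs_for_verts:
  assumes "ready s" "J 0 (set_scalar u 0 s)" and u: "u \<noteq> ''n''" "u \<noteq> ''reject''"
    and body: "\<And>k s'. k < n \<Longrightarrow> J k s' \<Longrightarrow> ready s' \<Longrightarrow> scalar s' u = k \<Longrightarrow>
      runs W body s' K (\<lambda>s''. ready s'' \<and> scalar s'' u = k \<and> J (Suc k) (set_scalar u (Suc k) s''))"
    and post: "\<And>s'. ready s' \<Longrightarrow> J n s' \<Longrightarrow> Q s'"
    and T: "(K + 2) * n + 2 \<le> T"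
  shows "runs W (for_verts u body) s T Q"
proof -
  let ?I = "\<lambda>s. ready s \<and> scalar s u \<le> n \<and> J (scalar s u) s"
  have "runs W (While (Less (Var u) (Var ''n'')) (Seq body (Assign u (Add (Var u) (Const 1)))))
    (set_scalar u 0 s) (T - 1) Q"
  proof (rule runs_While[where I = ?I and V = "\<lambda>s. (K + 2) * (n - scalar s u)"], goal_cases)
    case 1
    then show ?case using assms by simp
  next
    case (2 s')
    then have k: "scalar s' u < n" "ready s'" "J (scalar s' u) s'" by (auto simp: ready_def)
    then have "n - scalar s' u = Suc (n - Suc (scalar s' u))" by simp
    then have "K + 2 + (K + 2) * (n - Suc (scalar s' u)) = (K + 2) * (n - scalar s' u)" by simp
    then have "runs W (Seq body (Assign u (Add (Var u) (Const 1)))) s' (K + 1)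
      (\<lambda>s''. ?I s'' \<and> K + 1 + 1 + (K + 2) * (n - scalar s'' u) \<le> (K + 2) * (n - scalar s' u))"
      using k u W by (intro runs_Seq[of _ _ _ K _ 1] runs_mono[OF body[of "scalar s' u" s']]) auto
    then show ?case by blast
  next
    case (3 s')
    then have "scalar s' u = n" by (simp add: ready_def)
    with 3 post show ?case by simp
  qed (use T in simp)
  then show ?thesis using T by (simp add: for_verts_def)
qed

text \<open>\<open>J 0\<close> is required after any change of \<open>i\<close> and
  \<open>j\<close>, so that users need not know the offsets. Each round costs \<open>K\<close> and 3
  for read, increment and test; the constant 4 is the setup and the last test.\<close>

lemma runs_for_nbrs:
  assumes s: "ready s" "scalar s v < n"
    and init: "\<And>s'. changes_only {i, j} {} s s' \<Longrightarrow> J 0 s'"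
    and names: "i \<noteq> j" "u \<noteq> i" "u \<noteq> j" "v \<noteq> i" "v \<noteq> j" "''n'' \<notin> {i, j, u}" "''reject'' \<notin> {i, j, u}"
    and body: "\<And>k s'. k < deg (scalar s v) \<Longrightarrow> J k s' \<Longrightarrow> ready s' \<Longrightarrow>
      runs W body (set_scalar u (L ! scalar s v ! k) s') K
        (\<lambda>s''. ready s'' \<and> scalar s'' i = scalar s' i \<and> scalar s'' j = scalar s' j \<and>
           J (Suc k) (set_scalar i (Suc (scalar s' i)) s''))"
    and post: "\<And>s'. ready s' \<Longrightarrow> J (deg (scalar s v)) s' \<Longrightarrow> Q s'"
    and T: "(K + 3) * deg (scalar s v) + 4 \<le> T"
  shows "runs W (for_nbrs i j u v body) s T Q"
proof -
  define x where "x = scalar s v"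
  have x: "x < n" using s by (simp add: x_def)
  obtain T' where T3: "T = Suc (Suc (Suc T'))"
    using T by (intro that[of "T - 3"]) simp
  let ?s0 = "set_scalar j (offset (Suc x)) (set_scalar j (Suc x) (set_scalar i (offset x) s))"
  let ?I = "\<lambda>s'. ready s' \<and> scalar s' j = offset (Suc x) \<and>
    (\<exists>k \<le> deg x. scalar s' i = offset x + k \<and> J k s')"
  let ?V = "\<lambda>s'. (K + 3) * (offset (Suc x) - scalar s' i)"
  have "runs W (While (Less (Var i) (Var j))
       (Seq (Assign u (Read ''adj'' (Var i)))
       (Seq body (Assign i (Add (Var i) (Const 1)))))) ?s0 T' Q"
  proof (rule runs_While[where I = ?I and V = ?V], goal_cases)
    case 1
    have "J 0 ?s0" by (rule init) simp
    then show ?case using s names by auto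
  next
    case (2 s')
    then obtain k where k: "k \<le> deg x" "scalar s' i = offset x + k" "J k s'" by auto
    then have k': "k < deg x" using 2 offset_Suc[OF x] by simp
    let ?w = "L ! x ! k"
    have w: "array s' ''adj'' (offset x + k) = ?w" using ready_adj x k' 2 by simp
    have wW: "?w \<le> W" using nth_L[OF x k'] adj_less W by fastforce
    have "offset (Suc x) - scalar s' i = Suc (offset (Suc x) - Suc (scalar s' i))"
      using 2 by simp
    then have V: "?V s' = K + 3 + (K + 3) * (offset (Suc x) - Suc (scalar s' i))"
      by (simp del: diff_Suc_Suc)
    have *: "scalar s'' i + 1 \<le> W" if "scalar s'' i = scalar s' i" for s''
      using that k k' offset_Suc[OF x] offset_le[of "Suc x"] W by linarith
    have "runs W (Seq body (Assign i (Add (Var i) (Const 1)))) (set_scalar u ?w s') (K + 1)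
      (\<lambda>s''. ?I s'' \<and> K + 2 + 1 + ?V s'' \<le> ?V s')"
    proof (rule runs_Seq[of _ _ _ K _ 1], rule runs_mono[OF body[of k s', folded x_def]], goal_cases)
      case (5 s'')
      then show ?case
        using k k' names 2 V *[of s''] by (auto intro!: exI[of _ "Suc k"])
    qed (use k k' 2 x_def in auto)
    then have "runs W (Seq (Assign u (Read ''adj'' (Var i))) (Seq body (Assign i (Add (Var i) (Const 1)))))
      s' (K + 2) (\<lambda>s''. ?I s'' \<and> K + 2 + 1 + ?V s'' \<le> ?V s')"
      using wW w k by simp
    then show ?case by blast
  next
    case (3 s')
    then obtain k where k: "k \<le> deg x" "scalar s' i = offset x + k" "J k s'" by auto
    with 3 offset_Suc[OF x] have "k = deg x" by auto
    with k 3 post show ?case by (simp add: x_def)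
  next
    case 4
    then show ?case using T T3 offset_Suc[OF x] names by (simp add: x_def)
  qed
  moreover have "array s ''off'' x = offset x" "array s ''off'' (Suc x) = offset (Suc x)"
    using ready_off s x by auto
  moreover have "offset x \<le> W" "offset (Suc x) \<le> W" "Suc x \<le> W"
    using offset_le[of x] offset_le[of "Suc x"] W x by auto
  ultimately show ?thesis
    using names by (simp add: for_nbrs_def x_def T3)
qed

end

section \<open>Breadth-first search\<close>

context conn_graph
begin

text \<open>The first \<open>t\<close> entries of the queue \<open>Q\<close> have been discovered and the first \<open>h\<close> of them
  expanded; \<open>D\<close> is the distance plus one, so that zero marks undiscovered vertices.\<close>

definition bfs_inv ::
    "'a \<Rightarrow> (nat \<Rightarrow> 'a) \<Rightarrow> ('a \<Rightarrow> nat) \<Rightarrow> ('a \<Rightarrow> 'a) \<Rightarrow> nat \<Rightarrow> nat \<Rightarrow> bool" where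
  "bfs_inv src Q D P h t \<longleftrightarrow>
     Q ` {..<t} \<subseteq> verts G \<and> inj_on Q {..<t} \<and> src \<in> Q ` {..<t} \<and> P src = src \<and> h \<le> t \<and>
     (\<forall>v\<in>verts G. D v \<noteq> 0 \<longleftrightarrow> v \<in> Q ` {..<t}) \<and>
     (\<forall>v\<in>Q ` {..<t}. D v = Suc (dist src v)) \<and>
     (\<forall>v\<in>Q ` {..<t}. v \<noteq> src \<longrightarrow> adj (P v) v \<and> dist src v = Suc (dist src (P v))) \<and>
     (\<forall>i j. i \<le> j \<longrightarrow> j < t \<longrightarrow> dist src (Q i) \<le> dist src (Q j)) \<and>
     (h < t \<longrightarrow> (\<forall>i<t. dist src (Q i) \<le> Suc (dist src (Q h)))) \<and>
     (\<forall>i<h. nbrs (Q i) \<subseteq> Q ` {..<t})"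

lemma bfs_inv_init:
  assumes "src \<in> verts G" "\<And>v. v \<in> verts G \<Longrightarrow> D v = (if v = src then 1 else 0)"
    "P src = src" "Q 0 = src"
  shows "bfs_inv src Q D P 0 1"
proof -
  have "Q ` {..<1} = {src}" using assms(4) by (auto simp: lessThan_Suc)
  moreover have "dist src src = 0" using dist_0_iff assms(1) by simp
  moreover have "inj_on Q {..<1}" by (auto simp: inj_on_def)
  ultimately show ?thesis using assms unfolding bfs_inv_def by auto
qed

text \<open>By induction on the distance, a predecessor of \<open>w\<close> has been expanded, so
  \<open>w\<close> is in the queue. The queue is sorted by distance, so \<open>w\<close> stands
  before position \<open>h\<close>.\<close>

lemma bfs_closer_expanded:
  assumes inv: "bfs_inv src Q D P h t" and h: "h < t"
    and w: "w \<in> verts G" "dist src w < dist src (Q h)"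
  shows "w \<in> Q ` {..<h}"
  using w
proof (induction "dist src w" arbitrary: w)
  case 0
  have src: "src \<in> verts G" "src \<in> Q ` {..<t}" using inv by (auto simp: bfs_inv_def)
  then have "w \<in> Q ` {..<t}" using 0 dist_0_iff[of src w] by simp
  then obtain i where "i < t" "w = Q i" by auto
  moreover have "\<not> h \<le> i"
    using 0 calculation inv[unfolded bfs_inv_def] by (metis leD)
  ultimately show ?case by auto
next
  case (Suc k)
  have src: "src \<in> verts G" using inv by (auto simp: bfs_inv_def)
  obtain v where v: "adj v w" "dist src v = k"
    using dist_pred[OF src Suc.prems(1) Suc.hyps(2)[symmetric]] .
  then have "v \<in> Q ` {..<h}" using Suc adj_verts by simp
  then have "w \<in> Q ` {..<t}" using inv v by (auto simp: bfs_inv_def)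
  then obtain i where "i < t" "w = Q i" by auto
  moreover have "\<not> h \<le> i"
    using Suc.prems calculation inv[unfolded bfs_inv_def] by (metis leD)
  ultimately show ?case by auto
qed

text \<open>If \<open>u\<close> were at most as far as \<open>Q h\<close>, its predecessor would be
  strictly closer, hence already expanded, and \<open>u\<close> would have been discovered. So its
  distance is exactly one more than that of \<open>Q h\<close>.\<close>

lemma bfs_inv_discover:
  assumes inv: "bfs_inv src Q D P h t" and h: "h < t" and u: "adj (Q h) u" "D u = 0"
    and d: "d = Suc (D (Q h))"
  shows "bfs_inv src (Q(t := u)) (D(u := d)) (P(u := Q h)) h (Suc t)"
proof -
  have src: "src \<in> verts G" using inv by (auto simp: bfs_inv_def)
  have uV: "u \<in> verts G" using u adj_verts by simp
  have uQ: "u \<notin> Q ` {..<t}" using inv u uV by (auto simp: bfs_inv_def)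
  then have us: "u \<noteq> src" using inv by (auto simp: bfs_inv_def)
  have "\<not> dist src u \<le> dist src (Q h)"
  proof
    assume le: "dist src u \<le> dist src (Q h)"
    obtain k where k: "dist src u = Suc k"
      using us dist_0_iff[OF src uV] by (cases "dist src u") auto
    obtain w where w: "adj w u" "dist src w = k" using dist_pred[OF src uV k] .
    then have "w \<in> Q ` {..<h}"
      using bfs_closer_expanded[OF inv h] adj_verts le k by simp
    then have "u \<in> Q ` {..<t}" using inv w by (auto simp: bfs_inv_def)
    with uQ show False by simp
  qed
  then have du: "dist src u = Suc (dist src (Q h))"
    using dist_step[OF src u(1)] by simp
  have Dh: "D (Q h) = Suc (dist src (Q h))" using inv h by (auto simp: bfs_inv_def)
  have im: "(Q(t := u)) ` {..<Suc t} = insert u (Q ` {..<t})"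
    by (auto simp: lessThan_Suc)
  have inj: "inj_on (Q(t := u)) {..<Suc t}"
    using inv uQ by (auto simp: bfs_inv_def inj_on_def less_Suc_eq)
  have mono: "dist src ((Q(t := u)) i) \<le> dist src ((Q(t := u)) j)" if "i \<le> j" "j < Suc t" for i j
    using that inv h du by (auto simp: bfs_inv_def)
  show ?thesis
    unfolding bfs_inv_def im
  proof (intro conjI)
    show "\<forall>v\<in>insert u (Q ` {..<t}). v \<noteq> src \<longrightarrow>
      adj ((P(u := Q h)) v) v \<and> dist src v = Suc (dist src ((P(u := Q h)) v))"
      using inv u du by (auto simp: bfs_inv_def)
    show "\<forall>v\<in>insert u (Q ` {..<t}). (D(u := d)) v = Suc (dist src v)"
      using inv du Dh d by (auto simp: bfs_inv_def)
    show "\<forall>v\<in>verts G. ((D(u := d)) v \<noteq> 0) = (v \<in> insert u (Q ` {..<t}))"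
      using inv d by (auto simp: bfs_inv_def)
    show "h < Suc t \<longrightarrow> (\<forall>i<Suc t. dist src ((Q(t := u)) i) \<le> Suc (dist src ((Q(t := u)) h)))"
      using inv h du by (auto simp: bfs_inv_def less_Suc_eq)
    show "\<forall>i<h. nbrs ((Q(t := u)) i) \<subseteq> insert u (Q ` {..<t})"
      using inv h by (auto simp: bfs_inv_def)
  qed (use inv uV us inj mono in \<open>auto simp: bfs_inv_def\<close>)
qed

lemma bfs_inv_expanded:
  assumes inv: "bfs_inv src Q D P h t" and h: "h < t" and "\<And>u. adj (Q h) u \<Longrightarrow> D u \<noteq> 0"
  shows "bfs_inv src Q D P (Suc h) t"
proof -
  have n: "nbrs (Q h) \<subseteq> Q ` {..<t}" using assms adj_verts by (fastforce simp: bfs_inv_def)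
  have m: "\<forall>i<t. dist src (Q i) \<le> Suc (dist src (Q (Suc h)))" if "Suc h < t"
  proof (intro allI impI)
    fix i assume "i < t"
    then have "dist src (Q i) \<le> Suc (dist src (Q h))" using inv h by (auto simp: bfs_inv_def)
    moreover have "dist src (Q h) \<le> dist src (Q (Suc h))" using inv that by (auto simp: bfs_inv_def)
    ultimately show "dist src (Q i) \<le> Suc (dist src (Q (Suc h)))" by simp
  qed
  show ?thesis
    using inv n m h unfolding bfs_inv_def by (auto simp: less_Suc_eq)
qed

lemma bfs_inv_bound: "bfs_inv src Q D P h t \<Longrightarrow> t \<le> card (verts G)"
  using card_inj_on_le[of Q "{..<t}" "verts G"] by (auto simp: bfs_inv_def)

text \<open>The source is its own parent, so iterating \<open>P\<close> never leaves the
  vertices.\<close>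

definition bfs_tree :: "'a \<Rightarrow> ('a \<Rightarrow> 'a) \<Rightarrow> bool" where
  "bfs_tree src P \<longleftrightarrow> P src = src \<and>
     (\<forall>v\<in>verts G. v \<noteq> src \<longrightarrow> adj (P v) v \<and> dist src v = Suc (dist src (P v)))"

definition farthest :: "'a \<Rightarrow> 'a \<Rightarrow> bool" where
  "farthest src x \<longleftrightarrow> x \<in> verts G \<and> (\<forall>v\<in>verts G. dist src v \<le> dist src x)"

text \<open>Once the whole queue is expanded, induction on the distance shows that every vertex is
  in it; the last entry is farthest because the queue is sorted.\<close>

lemma bfs_inv_final:
  assumes inv: "bfs_inv src Q D P t t"
  shows "0 < t" "bfs_tree src P" "farthest src (Q (t - 1))" "D (Q (t - 1)) = Suc (dist src (Q (t - 1)))"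
proof -
  have src: "src \<in> verts G" "src \<in> Q ` {..<t}" using inv by (auto simp: bfs_inv_def)
  then show t: "0 < t" by auto
  have all: "v \<in> Q ` {..<t}" if "v \<in> verts G" for v
    using that
  proof (induction "dist src v" arbitrary: v)
    case 0
    then show ?case using src dist_0_iff by force
  next
    case (Suc k)
    obtain w where "adj w v" "dist src w = k" using dist_pred[OF src(1) Suc.prems Suc.hyps(2)[symmetric]] .
    moreover from this have "w \<in> Q ` {..<t}" using Suc.hyps(1)[of w] adj_verts by simp
    ultimately show ?case using inv by (auto simp: bfs_inv_def)
  qed
  have "P src = src"
    "\<forall>v\<in>Q ` {..<t}. v \<noteq> src \<longrightarrow> adj (P v) v \<and> dist src v = Suc (dist src (P v))"
    using inv unfolding bfs_inv_def by simp_all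
  with all show "bfs_tree src P" unfolding bfs_tree_def by blast
  have "dist src v \<le> dist src (Q (t - 1))" if v: "v \<in> verts G" for v
  proof -
    obtain i where "i < t" "v = Q i" using all[OF v] by auto
    moreover have "i \<le> t - 1" using calculation by simp
    ultimately show ?thesis using inv t by (auto simp: bfs_inv_def)
  qed
  then show "farthest src (Q (t - 1))" using inv t by (auto simp: farthest_def bfs_inv_def)
  show "D (Q (t - 1)) = Suc (dist src (Q (t - 1)))" using inv t by (auto simp: bfs_inv_def)
qed

text \<open>One half of the handshake lemma: each edge accounts for at most two ordered
  pairs.\<close>

lemma card_ordered_edges: "card {(u, v). adj u v} \<le> 2 * card (edges G)"
proof -
  have fin: "finite (edges G)"
  proof (rule finite_subset)
    show "edges G \<subseteq> Pow (verts G)" using simple by (fastforce simp: simple_graph_def)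
  qed simp
  have "{(u, v). adj u v} = (\<Union>e\<in>edges G. {(u, v). {u, v} = e})" by (auto simp: adj_def)
  also have "card \<dots> \<le> (\<Sum>e\<in>edges G. card {(u, v). {u, v} = e})" by (rule card_UN_le[OF fin])
  also have "\<dots> \<le> (\<Sum>e\<in>edges G. 2)"
  proof (rule sum_mono)
    fix e assume "e \<in> edges G"
    then obtain a b where "e = {a, b}" using simple by (auto simp: simple_graph_def)
    then have "{(u, v). {u, v} = e} \<subseteq> {(a, b), (b, a)}" by (auto simp: doubleton_eq_iff)
    then have "card {(u, v). {u, v} = e} \<le> card {(a, b), (b, a)}" by (intro card_mono) auto
    also have "\<dots> \<le> 2" by (cases "a = b") auto
    finally show "card {(u, v). {u, v} = e} \<le> 2" .
  qed
  finally show ?thesis by simp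
qed

end

context input
begin

lemma sum_deg: "(\<Sum>v<n. deg v) = length (concat L)"
  by (simp add: length_concat sum_list_sum_nth atLeast0LessThan)

lemma length_concat_le: "length (concat L) \<le> 2 * card (edges G)"
proof -
  have "length (concat L) = (\<Sum>v<n. card (nbrs v))" by (simp add: sum_deg[symmetric] deg_eq)
  also have "\<dots> = card (SIGMA v:{..<n}. nbrs v)" by simp
  also have "(SIGMA v:{..<n}. nbrs v) = {(u, v). adj u v}" using adj_less by auto
  also have "card \<dots> \<le> 2 * card (edges G)" by (rule card_ordered_edges)
  finally show ?thesis .
qed

end

section \<open>Breadth-first search as a program, with its running time\<close>

abbreviation (input) seq :: "program \<Rightarrow> program \<Rightarrow> program" (infixr ";;" 60) where
  "c1 ;; c2 \<equiv> Seq c1 c2"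

definition bfs_expand :: program where
  "bfs_expand =
     for_nbrs ''i'' ''j'' ''u'' ''v''
       (Assign ''x'' (Read ''dist'' (Var ''u'')) ;;
        If (Equal (Var ''x'') (Const 0))
          (Write ''dist'' (Var ''u'') (Var ''d'') ;;
           Write ''par'' (Var ''u'') (Var ''v'') ;;
           Write ''queue'' (Var ''tail'') (Var ''u'') ;;
           Assign ''tail'' (Add (Var ''tail'') (Const 1)))
          Skip)"

definition bfs_loop :: program where
  "bfs_loop =
     While (Less (Var ''head'') (Var ''tail''))
       (Assign ''v'' (Read ''queue'' (Var ''head'')) ;;
        Assign ''d'' (Read ''dist'' (Var ''v'')) ;;
        Assign ''d'' (Add (Var ''d'') (Const 1)) ;;
        bfs_expand ;;
        Assign ''head'' (Add (Var ''head'') (Const 1)))"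

text \<open>Clearing \<open>dist\<close> first allows a second search on the arrays left by an
  earlier one. As \<open>dist\<close> stores the distance plus one, \<open>len\<close> is the number
  of vertices of a shortest path to \<open>last\<close>.\<close>

definition bfs :: program where
  "bfs =
     (for_verts ''u'' (Write ''dist'' (Var ''u'') (Const 0)) ;;
      Write ''dist'' (Var ''src'') (Const 1) ;;
      Write ''par'' (Var ''src'') (Var ''src'') ;;
      Write ''queue'' (Const 0) (Var ''src'') ;;
      Assign ''head'' (Opd (Const 0)) ;;
      Assign ''tail'' (Opd (Const 1)) ;;
      bfs_loop ;;
      Assign ''x'' (Sub (Var ''tail'') (Const 1)) ;;
      Assign ''last'' (Read ''queue'' (Var ''x'')) ;;
      Assign ''len'' (Read ''dist'' (Var ''last'')))"

context input
begin

abbreviation bfs_scalars :: "name set" where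
  "bfs_scalars \<equiv> {''u'', ''v'', ''x'', ''d'', ''i'', ''j'', ''head'', ''tail'', ''last'', ''len''}"

abbreviation bfs_arrays :: "name set" where
  "bfs_arrays \<equiv> {''dist'', ''par'', ''queue''}"

text \<open>The number \<open>h\<close> of expanded entries is a parameter because it is ahead of
  \<open>head\<close> between an expansion and the increment.\<close>

definition bfs_state :: "nat \<Rightarrow> nat \<Rightarrow> state \<Rightarrow> bool" where
  "bfs_state src h s \<longleftrightarrow>
     bfs_inv src (array s ''queue'') (array s ''dist'') (array s ''par'') h (scalar s ''tail'')"

lemma dist_less: "u < n \<Longrightarrow> v < n \<Longrightarrow> dist u v < n"
  using dist_less_card[of u v] by (simp add: verts_eq)

lemma bfs_state_queue: "bfs_state src h s \<Longrightarrow> k < scalar s ''tail'' \<Longrightarrow> array s ''queue'' k < n"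
  by (auto simp: bfs_state_def bfs_inv_def verts_eq)

lemma bfs_state_dist_le: "bfs_state src h s \<Longrightarrow> v < n \<Longrightarrow> array s ''dist'' v \<le> n"
proof -
  assume s: "bfs_state src h s" and v: "v < n"
  have "src < n" using s by (auto simp: bfs_state_def bfs_inv_def verts_eq)
  then have "Suc (dist src v) \<le> n" using v dist_less by (simp add: Suc_le_eq)
  with s v show ?thesis
    unfolding bfs_state_def bfs_inv_def verts_eq by (metis lessThan_iff le0)
qed

lemma runs_bfs_expand:
  assumes "ready s" "bfs_state src h s" "h < scalar s ''tail''"
    and v: "scalar s ''v'' = array s ''queue'' h"
    and d: "scalar s ''d'' = Suc (array s ''dist'' (scalar s ''v''))"
  shows "runs W bfs_expand s (9 * deg (scalar s ''v'') + 4)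
        (\<lambda>s'. ready s' \<and> bfs_state src (Suc h) s' \<and> h < scalar s' ''tail'' \<and>
           (\<forall>k\<le>h. array s' ''queue'' k = array s ''queue'' k) \<and>
           changes_only {''i'', ''j'', ''u'', ''x'', ''tail''} bfs_arrays s s')"
proof -
  let ?v = "scalar s ''v''"
  let ?J = "\<lambda>k s'. bfs_state src h s' \<and> h < scalar s' ''tail'' \<and>
     (\<forall>k\<le>h. array s' ''queue'' k = array s ''queue'' k) \<and>
     array s' ''dist'' ?v = array s ''dist'' ?v \<and>
     (\<forall>w\<in>set (take k (L ! ?v)). array s' ''dist'' w \<noteq> 0) \<and>
     changes_only {''i'', ''j'', ''u'', ''x'', ''tail''} bfs_arrays s s'"
  have vn: "?v < n" using bfs_state_queue assms by simp
  have Dv: "array s ''dist'' ?v \<noteq> 0"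
    using assms(2,3) by (auto simp: bfs_state_def bfs_inv_def v)
  show ?thesis
    unfolding bfs_expand_def
  \<comment> \<open>The body costs at most 6: a read, a test and four instructions for a newly
    discovered vertex.\<close>
  proof (rule runs_for_nbrs[where J = ?J and K = 6], goal_cases)
    case 1
    show ?case by fact
  next
    case 2
    show ?case by fact
  next
    case (3 s')
    then show ?case
      using assms by (auto simp: bfs_state_def changes_only_def)
  next
    case (11 k s')
    let ?u = "L ! ?v ! k"
    have u: "adj ?v ?u" "?u < n" using nth_L[OF vn] adj_less 11 by blast+
    have t: "take (Suc k) (L ! ?v) = take k (L ! ?v) @ [?u]"
      using 11 by (simp add: take_Suc_conv_app_nth)
    have tn: "scalar s' ''tail'' \<le> n"
      using 11 bfs_inv_bound by (auto simp: bfs_state_def verts_eq)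
    have q: "array s' ''queue'' h = ?v" using 11 v by simp
    have sc: "scalar s' ''v'' = ?v" "scalar s' ''d'' = scalar s ''d''"
      using 11 changes_only_scalar[of "{''i'', ''j'', ''u'', ''x'', ''tail''}" bfs_arrays s s'] by simp_all
    have dW: "scalar s ''d'' \<le> W" "array s' ''dist'' ?u \<le> W"
      using bfs_state_dist_le[OF assms(2) vn] bfs_state_dist_le[of src h s' ?u] 11 u d W by auto
    show ?case
    proof (cases "array s' ''dist'' ?u = 0")
      case True
      then have "?u \<noteq> ?v" using Dv 11 by auto
      moreover have "bfs_inv src ((array s' ''queue'')(scalar s' ''tail'' := ?u))
        ((array s' ''dist'')(?u := scalar s ''d'')) ((array s' ''par'')(?u := ?v)) h
        (Suc (scalar s' ''tail''))"
        using bfs_inv_discover[of src "array s' ''queue''" "array s' ''dist''" "array s' ''par''" h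
          "scalar s' ''tail''" ?u "scalar s ''d''"] 11 True u q d
        by (simp add: bfs_state_def)
      ultimately show ?thesis
        using 11 True u tn dW W sc vn d t by (auto simp: bfs_state_def)
    next
      case False
      then show ?thesis using 11 dW t by (auto simp: bfs_state_def)
    qed
  next
    case (12 s')
    then have "\<And>u. adj ?v u \<Longrightarrow> array s' ''dist'' u \<noteq> 0" using set_L[OF vn] by auto
    with 12 v show ?case
      using bfs_inv_expanded[of src "array s' ''queue''" "array s' ''dist''" "array s' ''par''" h
          "scalar s' ''tail''"]
      by (auto simp: bfs_state_def)
  qed auto
qed

lemma runs_bfs_loop:
  assumes s: "ready s" "bfs_state src 0 s" "scalar s ''head'' = 0"
  shows "runs W bfs_loop s (9 * n + 9 * length (concat L) + 1)
     (\<lambda>s'. ready s' \<and> bfs_state src (scalar s' ''tail'') s' \<and>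
        changes_only bfs_scalars bfs_arrays s s')"
proof -
  let ?I = "\<lambda>s'. ready s' \<and> bfs_state src (scalar s' ''head'') s' \<and>
     changes_only bfs_scalars bfs_arrays s s'"
  \<comment> \<open>The potential ranges over the vertices not yet expanded. The iteration for
    \<open>x\<close> takes \<open>9 * deg x + 8\<close> and one test, which is the share of
    \<open>x\<close>; entries of the queue are distinct, so each share is spent once.\<close>
  let ?V = "\<lambda>s'. \<Sum>v\<in>{..<n} - array s' ''queue'' ` {..<scalar s' ''head''}. 9 * deg v + 9"
  show ?thesis
    unfolding bfs_loop_def
  proof (rule runs_While[where I = ?I and V = ?V], goal_cases)
    case 1
    then show ?case using s by simp
  next
    case (2 s1)
    note loop_state = 2
    define h where "h = scalar s1 ''head''"
    define x where "x = array s1 ''queue'' h"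
    have h: "h < scalar s1 ''tail''" using 2 by (simp add: h_def)
    have inv: "bfs_state src h s1" using 2 by (simp add: h_def)
    have x: "x < n" unfolding x_def by (rule bfs_state_queue[OF inv h])
    have hn: "h < n"
      using h inv bfs_inv_bound by (fastforce simp: bfs_state_def verts_eq)
    have xW: "x \<le> W" "Suc (array s1 ''dist'' x) \<le> W"
      using bfs_state_dist_le[OF inv x] x W by auto
    let ?s2 = "set_scalar ''d'' (Suc (array s1 ''dist'' x))
      (set_scalar ''d'' (array s1 ''dist'' x) (set_scalar ''v'' x s1))"
    have xnew: "x \<notin> array s1 ''queue'' ` {..<h}"
    proof
      assume "x \<in> array s1 ''queue'' ` {..<h}"
      then obtain i where i: "i < h" "array s1 ''queue'' h = array s1 ''queue'' i"
        by (auto simp: x_def)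
      moreover have "inj_on (array s1 ''queue'') {..<scalar s1 ''tail''}"
        using inv by (simp add: bfs_state_def bfs_inv_def)
      ultimately show False using h by (auto dest: inj_onD)
    qed
    have V: "?V s1 = 9 * deg x + 9 + (\<Sum>v\<in>{..<n} - array s1 ''queue'' ` {..<Suc h}. 9 * deg v + 9)"
    proof -
      have "{..<n} - array s1 ''queue'' ` {..<Suc h} = {..<n} - array s1 ''queue'' ` {..<h} - {x}"
        by (auto simp: lessThan_Suc x_def)
      moreover have "x \<in> {..<n} - array s1 ''queue'' ` {..<h}" using x xnew by simp
      ultimately show ?thesis
        using sum.remove[of "{..<n} - array s1 ''queue'' ` {..<h}" x "\<lambda>v. 9 * deg v + 9"]
        by (simp add: h_def)
    qed
    have "runs W bfs_expand ?s2 (9 * deg (scalar ?s2 ''v'') + 4)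
        (\<lambda>s'. ready s' \<and> bfs_state src (Suc h) s' \<and> h < scalar s' ''tail'' \<and>
           (\<forall>k\<le>h. array s' ''queue'' k = array ?s2 ''queue'' k) \<and>
           changes_only {''i'', ''j'', ''u'', ''x'', ''tail''} bfs_arrays ?s2 s')"
      by (rule runs_bfs_expand) (use 2 h inv in \<open>auto simp: bfs_state_def x_def\<close>)
    then have expand: "runs W bfs_expand ?s2 (9 * deg x + 4)
        (\<lambda>s'. ready s' \<and> bfs_state src (Suc h) s' \<and> h < scalar s' ''tail'' \<and>
           (\<forall>k\<le>h. array s' ''queue'' k = array s1 ''queue'' k) \<and>
           changes_only {''i'', ''j'', ''u'', ''x'', ''tail''} bfs_arrays ?s2 s')"
      by simp
    have "runs W (bfs_expand ;; Assign ''head'' (Add (Var ''head'') (Const 1))) ?s2 (5 + 9 * deg x)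
      (\<lambda>s'. ?I s' \<and> (9 * deg x + 8) + 1 + ?V s' \<le> ?V s1)"
    proof (rule runs_SeqI[where U = 1, OF expand], goal_cases)
      case (1 s3)
      have c2: "changes_only {''i'', ''j'', ''u'', ''x'', ''tail''} bfs_arrays ?s2 s3"
        using 1 by blast
      have hd: "scalar s3 ''head'' = h"
        using changes_only_scalar[OF c2, of "''head''"] by (simp add: h_def)
      have "changes_only bfs_scalars bfs_arrays s ?s2" using loop_state by simp
      then have c: "changes_only bfs_scalars bfs_arrays s s3"
        using c2 by (rule changes_only_trans) simp_all
      have im: "array s3 ''queue'' ` {..<Suc h} = array s1 ''queue'' ` {..<Suc h}"
        using 1 by (intro image_cong) auto
      show ?case using 1 hd c im hn W V by (auto simp: bfs_state_def)
    qed auto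
    then have "runs W
       (Assign ''v'' (Read ''queue'' (Var ''head'')) ;;
        Assign ''d'' (Read ''dist'' (Var ''v'')) ;;
        Assign ''d'' (Add (Var ''d'') (Const 1)) ;;
        bfs_expand ;;
        Assign ''head'' (Add (Var ''head'') (Const 1))) s1 (Suc (Suc (Suc (5 + 9 * deg x))))
      (\<lambda>s'. ?I s' \<and> (9 * deg x + 8) + 1 + ?V s' \<le> ?V s1)"
      using xW by (simp add: x_def h_def)
    moreover have "Suc (Suc (Suc (5 + 9 * deg x))) = 9 * deg x + 8" by simp
    ultimately show ?case by metis
  next
    case (3 s1)
    then have "bfs_inv src (array s1 ''queue'') (array s1 ''dist'') (array s1 ''par'')
      (scalar s1 ''head'') (scalar s1 ''tail'')" "scalar s1 ''tail'' \<le> scalar s1 ''head''"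
      by (auto simp: bfs_state_def)
    moreover from this have "scalar s1 ''tail'' = scalar s1 ''head''"
      by (simp add: bfs_inv_def)
    ultimately show ?case using 3 by (simp add: bfs_state_def)
  next
    case 4
    have "(\<Sum>v<n. 9 * deg v + 9) = 9 * n + 9 * length (concat L)"
      by (simp add: sum.distrib sum_deg flip: sum_distrib_left)
    then show ?case using s by simp
  qed
qed

lemma runs_bfs:
  assumes "ready s" "scalar s ''src'' = src" "src < n"
  shows "runs W bfs s (12 * n + 9 * length (concat L) + 11)
     (\<lambda>s'. ready s' \<and> bfs_tree src (array s' ''par'') \<and> farthest src (scalar s' ''last'') \<and>
        scalar s' ''len'' = Suc (dist src (scalar s' ''last'')) \<and>
        changes_only bfs_scalars bfs_arrays s s')"
    (is "runs W bfs s _ ?Q")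
  unfolding bfs_def
proof (rule runs_Seq)
  let ?T = "9 * n + 9 * length (concat L)"
  let ?J = "\<lambda>k s'. changes_only bfs_scalars bfs_arrays s s' \<and> (\<forall>v<k. array s' ''dist'' v = 0)"
  \<comment> \<open>The five \<open>Suc\<close> are the instructions between clearing and loop; each
    is executed by a rule that lowers the bound by one.\<close>
  show "runs W (for_verts ''u'' (Write ''dist'' (Var ''u'') (Const 0))) s (3 * n + 2)
    (\<lambda>s1. runs W (Write ''dist'' (Var ''src'') (Const 1) ;;
      Write ''par'' (Var ''src'') (Var ''src'') ;;
      Write ''queue'' (Const 0) (Var ''src'') ;;
      Assign ''head'' (Opd (Const 0)) ;;
      Assign ''tail'' (Opd (Const 1)) ;;
      bfs_loop ;;
      Assign ''x'' (Sub (Var ''tail'') (Const 1)) ;;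
      Assign ''last'' (Read ''queue'' (Var ''x'')) ;;
      Assign ''len'' (Read ''dist'' (Var ''last''))) s1 (Suc (Suc (Suc (Suc (Suc (4 + ?T)))))) ?Q)"
  proof (rule runs_for_verts[where K = 1 and J = ?J], goal_cases)
    case (6 s1)
    let ?s2 = "set_scalar ''tail'' 1 (set_scalar ''head'' 0 (set_array ''queue'' 0 src
      (set_array ''par'' src src (set_array ''dist'' src 1 s1))))"
    have src: "scalar s1 ''src'' = src"
      using changes_only_scalar[of bfs_scalars bfs_arrays s s1 "''src''"] 6 assms by simp
    have c: "changes_only bfs_scalars bfs_arrays s ?s2" using 6 by simp
    have "bfs_state src 0 ?s2"
      unfolding bfs_state_def using 6 assms by (auto simp: verts_eq intro!: bfs_inv_init[simplified])
    then have loop: "runs W bfs_loop ?s2 (?T + 1)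
     (\<lambda>s'. ready s' \<and> bfs_state src (scalar s' ''tail'') s' \<and>
        changes_only bfs_scalars bfs_arrays ?s2 s')"
      by (intro runs_bfs_loop) (use 6 in auto)
    have "runs W (bfs_loop ;;
      Assign ''x'' (Sub (Var ''tail'') (Const 1)) ;;
      Assign ''last'' (Read ''queue'' (Var ''x'')) ;;
      Assign ''len'' (Read ''dist'' (Var ''last''))) ?s2 (4 + ?T) ?Q"
    proof (rule runs_SeqI[where U = 3, OF loop], goal_cases)
      case (1 s3)
      then have inv: "bfs_inv src (array s3 ''queue'') (array s3 ''dist'') (array s3 ''par'')
        (scalar s3 ''tail'') (scalar s3 ''tail'')" by (simp add: bfs_state_def)
      note final = bfs_inv_final[OF inv]
      let ?l = "array s3 ''queue'' (scalar s3 ''tail'' - Suc 0)"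
      have l: "?l < n" using final(3) by (simp add: farthest_def verts_eq)
      have "dist src ?l < n" using dist_less l assms by simp
      moreover have "scalar s3 ''tail'' \<le> n" using bfs_inv_bound[OF inv] by (simp add: verts_eq)
      moreover have "changes_only bfs_scalars bfs_arrays ?s2 s3" using 1 by blast
      then have "changes_only bfs_scalars bfs_arrays s s3"
        by (rule changes_only_trans[OF c]) simp_all
      ultimately show ?case
        using 1 final l W by (simp add: bfs_state_def del: array_set_array)
    qed simp
    then show ?case using src assms W by simp
  qed (use assms W in \<open>auto simp: less_Suc_eq\<close>)
qed simp

end

section \<open>Choosing the source of the search\<close>

context conn_graph
begin

definition far_from_some :: "'a \<Rightarrow> bool" where
  "far_from_some w \<longleftrightarrow> (\<exists>y\<in>verts G. 3 \<le> dist w y)"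

text \<open>A sufficient condition for the test of the neighbour \<open>w\<close> of \<open>v\<close> to succeed, whichever \<open>a\<close> it
  picks.\<close>

definition detectable :: "'a \<Rightarrow> 'a \<Rightarrow> bool" where
  "detectable v w \<longleftrightarrow> adj v w \<and> (\<exists>a. adj w a \<and> \<not> adj v a \<and> a \<noteq> v) \<and>
     (\<exists>y\<in>verts G. 3 \<le> dist w y \<and>
       (\<forall>a z. adj w a \<longrightarrow> \<not> adj v a \<longrightarrow> a \<noteq> v \<longrightarrow> z \<in> verts G \<longrightarrow>
         \<not> adj v z \<longrightarrow> \<not> adj w z \<longrightarrow> \<not> adj a z \<longrightarrow> z = y))"

text \<open>A pair at a larger distance would be at distance 4 or more and hence contain
  \<open>v\<close>, whose distances are at most \<open>dist v l\<close>.\<close>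

lemma far_source_diam:
  assumes free: "free_of G P2_plus_2P1" and v: "min_degree_vertex v"
    and l: "farthest v l" and 3: "3 \<le> dist v l"
  shows "dist v l = diam G"
proof (rule sym, rule diam_eqI)
  show "v \<in> verts G" "l \<in> verts G" using v l by (auto simp: min_degree_vertex_def farthest_def)
  fix x y assume xy: "x \<in> verts G" "y \<in> verts G"
  show "dist x y \<le> dist v l"
  proof (rule ccontr)
    assume "\<not> dist x y \<le> dist v l"
    moreover from this have "v \<in> {x, y}"
      using min_degree_dist_4[OF free v xy] 3 by simp
    ultimately show False using l xy dist_sym[OF xy] by (auto simp: farthest_def)
  qed
qed

text \<open>Distance 4 would involve \<open>v\<close>, which is near everything. Distance 3 yields a
  detectable neighbour, so \<open>src\<close> also has eccentricity at least 3. At distance at most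
  2, a failure forces \<open>src = v\<close> with eccentricity at most 1, and then the graph is
  complete by the choice of \<open>v\<close>.\<close>

lemma near_source_diam:
  assumes free: "free_of G P2_plus_2P1" and v: "min_degree_vertex v"
    and near: "farthest v l" "dist v l < 3"
    and src: "src = v \<or> far_from_some src" "\<And>w. detectable v w \<Longrightarrow> far_from_some src"
    and l': "farthest src l'" "src \<in> verts G"
  shows "dist src l' = diam G"
proof (rule sym, rule diam_eqI)
  show "src \<in> verts G" "l' \<in> verts G" using l' by (auto simp: farthest_def)
  have vV: "v \<in> verts G" using v by (simp add: min_degree_vertex_def)
  have near: "dist v z < 3" if "z \<in> verts G" for z
    using near that by (fastforce simp: farthest_def)
  have far: "3 \<le> dist src l'" if "far_from_some src"
    using that l' by (fastforce simp: far_from_some_def farthest_def)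
  fix x y assume xy: "x \<in> verts G" "y \<in> verts G"
  show "dist x y \<le> dist src l'"
  proof (rule ccontr)
    assume less: "\<not> dist x y \<le> dist src l'"
    consider "4 \<le> dist x y" | "dist x y = 3" | "dist x y \<le> 2" by linarith
    then show False
    proof cases
      case 1
      then have "v \<in> {x, y}" by (rule min_degree_dist_4[OF free v xy])
      then show False using 1 near[OF xy(1)] near[OF xy(2)] dist_sym[OF xy] by auto
    next
      case 2
      then have "3 \<le> dist x y" by simp
      from min_degree_dist_3[OF free v near xy this] obtain w where "detectable v w"
        unfolding detectable_def by metis
      then show False using src(2) far 2 less by auto
    next
      case 3
      then have [simp]: "src = v" using src(1) far less by auto
      have all: "z = v \<or> adj v z" if z: "z \<in> verts G" for z
      proof -
        have le: "dist v z \<le> 1" using l' z 3 less by (fastforce simp: farthest_def)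
        show ?thesis
        proof (cases "dist v z")
          case 0
          then show ?thesis using dist_0_iff[OF vV z] by simp
        next
          case (Suc k)
          obtain w where w: "adj w z" "dist v w = k" using dist_pred[OF vV z Suc] .
          then have "v = w" using le Suc dist_0_iff[of v w] vV adj_verts[OF w(1)] by simp
          then show ?thesis using w by simp
        qed
      qed
      have "x \<noteq> y" using less dist_0_iff[OF xy] by auto
      \<comment> \<open>Since \<open>v\<close> is adjacent to all other vertices and has minimum
        degree, so is \<open>x\<close>; then only eccentricity 0 of \<open>v\<close> remains, which
        contradicts \<open>x \<noteq> y\<close>.\<close>
      have "card (verts G - {v}) \<le> card (nbrs v)"
        by (intro card_mono) (use all in auto)
      also have "\<dots> \<le> card (nbrs x)" using v xy by (simp add: min_degree_vertex_def)
      finally have "card (verts G - {x}) \<le> card (nbrs x)" using vV xy by simp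
      moreover have "nbrs x \<subseteq> verts G - {x}" using adj_verts by auto
      ultimately have "nbrs x = verts G - {x}" by (intro card_seteq) auto
      then have "adj x y" using xy \<open>x \<noteq> y\<close> by auto
      then have xy1: "dist x y \<le> 1" using dist_step[OF xy(1), of x y] dist_0_iff[OF xy(1,1)] by simp
      then have "dist v l' = 0" using less by simp
      then have "\<forall>z\<in>verts G. dist v z = 0" using l' by (auto simp: farthest_def)
      then show False using xy vV dist_0_iff \<open>x \<noteq> y\<close> by metis
    qed
  qed
qed

end

section \<open>Programs that select the source\<close>

definition find_min_degree :: program where
  "find_min_degree =
     (Assign ''best'' (Opd (Var ''n'')) ;;
      for_verts ''u''
        (Assign ''x'' (Read ''off'' (Var ''u'')) ;;
         Assign ''y'' (Add (Var ''u'') (Const 1)) ;;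
         Assign ''y'' (Read ''off'' (Var ''y'')) ;;
         Assign ''x'' (Sub (Var ''y'') (Var ''x'')) ;;
         If (LessEq (Var ''x'') (Var ''best''))
           (Assign ''best'' (Opd (Var ''x'')) ;; Assign ''root'' (Opd (Var ''u'')))
           Skip))"

definition mark_nbrs :: "name \<Rightarrow> nat \<Rightarrow> program" where
  "mark_nbrs v c = for_nbrs ''k'' ''l'' ''u'' v (Write ''mark'' (Var ''u'') (Const c))"

definition mark_root :: program where
  "mark_root =
     (for_verts ''u'' (Write ''mark'' (Var ''u'') (Const 0)) ;;
      Write ''mark'' (Var ''root'') (Const 1) ;;
      mark_nbrs ''root'' 1)"

text \<open>Looks for a neighbour \<open>a\<close> of \<open>w\<close> outside the closed
  neighbourhood of \<open>root\<close>. If there is none, \<open>a\<close> stays \<open>w\<close>;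
  the marks then set on its neighbours are overwritten by 2.\<close>

definition pick_nbr :: program where
  "pick_nbr =
     (Assign ''a'' (Opd (Var ''w'')) ;;
      for_nbrs ''k'' ''l'' ''u'' ''w''
        (Assign ''x'' (Read ''mark'' (Var ''u'')) ;;
         If (Equal (Var ''x'') (Const 0)) (Assign ''a'' (Opd (Var ''u''))) Skip))"

text \<open>At this point \<open>mark\<close> is 2 on the neighbours of \<open>w\<close>, 1 on the remaining neighbours of
  \<open>root\<close> and \<open>a\<close>, and 0 elsewhere. If no vertex is left, \<open>y = w\<close>, which \<open>check_far\<close> refutes because
  of the neighbour \<open>root\<close> of \<open>w\<close>.\<close>

definition pick_far :: program where
  "pick_far =
     (Assign ''y'' (Opd (Var ''w'')) ;;
      for_verts ''u''
        (Assign ''x'' (Read ''mark'' (Var ''u'')) ;;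
         If (Equal (Var ''x'') (Const 0)) (Assign ''y'' (Opd (Var ''u''))) Skip))"

text \<open>For an unmarked \<open>y\<close>, which is no neighbour of \<open>w\<close>, a neighbour
  with mark 2 is a common neighbour with \<open>w\<close>; if there is none, the distance of
  \<open>w\<close> and \<open>y\<close> is at least 3.\<close>

definition check_far :: program where
  "check_far =
     (Assign ''ok'' (Opd (Const 1)) ;;
      for_nbrs ''k'' ''l'' ''u'' ''y''
        (Assign ''x'' (Read ''mark'' (Var ''u'')) ;;
         If (Equal (Var ''x'') (Const 2)) (Assign ''ok'' (Opd (Const 0))) Skip) ;;
      If (Equal (Var ''ok'') (Const 1)) (Assign ''src'' (Opd (Var ''w''))) Skip)"

definition try_nbr :: program where
  "try_nbr =
     (mark_root ;; pick_nbr ;; mark_nbrs ''a'' 1 ;; mark_nbrs ''w'' 2 ;; pick_far ;; check_far)"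

definition find_source :: program where
  "find_source = for_nbrs ''i'' ''j'' ''w'' ''root'' try_nbr"

context input
begin

section \<open>Correctness and running time of the selection\<close>

lemma deg_le: "v < n \<Longrightarrow> deg v \<le> n"
proof -
  assume v: "v < n"
  have "card (nbrs v) \<le> card {..<n}" using adj_less by (intro card_mono) auto
  then show ?thesis using deg_eq[OF v] by simp
qed

lemma runs_find_min_degree:
  assumes "ready s"
  shows "runs W find_min_degree s (9 * n + 3)
    (\<lambda>s'. ready s' \<and> min_degree_vertex (scalar s' ''root''))"
proof -
  \<comment> \<open>No degree exceeds the initial value \<open>n\<close> of \<open>best\<close>, so
    vertex 0 is always accepted and \<open>root\<close> is meaningful from then on.\<close>
  let ?J = "\<lambda>k s'. if k = 0 then scalar s' ''best'' = n
    else scalar s' ''root'' < n \<and> scalar s' ''best'' = deg (scalar s' ''root'') \<and>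
      (\<forall>u<k. scalar s' ''best'' \<le> deg u)"
  have "runs W (for_verts ''u''
        (Assign ''x'' (Read ''off'' (Var ''u'')) ;;
         Assign ''y'' (Add (Var ''u'') (Const 1)) ;;
         Assign ''y'' (Read ''off'' (Var ''y'')) ;;
         Assign ''x'' (Sub (Var ''y'') (Var ''x'')) ;;
         If (LessEq (Var ''x'') (Var ''best''))
           (Assign ''best'' (Opd (Var ''x'')) ;; Assign ''root'' (Opd (Var ''u'')))
           Skip)) (set_scalar ''best'' n s) (9 * n + 2)
    (\<lambda>s'. ready s' \<and> min_degree_vertex (scalar s' ''root''))"
  proof (rule runs_for_verts[where K = 7 and J = ?J], goal_cases)
    case (5 k s')
    have o: "array s' ''off'' k = offset k" "array s' ''off'' (Suc k) = offset k + deg k"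
      using ready_off[of s'] 5 offset_Suc by auto
    have "offset k + deg k \<le> W" using offset_le[of "Suc k"] offset_Suc[of k] 5 W by simp
    then show ?case
      using 5 o W deg_le[of k] by (auto simp: less_Suc_eq split: if_splits)
  next
    case (6 s')
    then show ?case using n_pos
      by (auto simp: min_degree_vertex_def verts_eq deg_eq[symmetric])
  qed (use assms in auto)
  then show ?thesis using assms W by (simp add: find_min_degree_def ready_def)
qed

lemma runs_mark_nbrs:
  assumes s: "ready s" "scalar s v < n" and v: "v \<notin> {''k'', ''l''}" and c: "c \<le> 2"
  shows "runs W (mark_nbrs v c) s (4 * n + 4)
    (\<lambda>s'. ready s' \<and> changes_only {''k'', ''l'', ''u''} {''mark''} s s' \<and>
       array s' ''mark'' = (\<lambda>z. if adj (scalar s v) z then c else array s ''mark'' z))"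
  unfolding mark_nbrs_def
proof (rule runs_for_nbrs[where K = 1 and J = "\<lambda>k s'.
    changes_only {''k'', ''l'', ''u''} {''mark''} s s' \<and>
    array s' ''mark'' = (\<lambda>z. if z \<in> set (take k (L ! scalar s v)) then c else array s ''mark'' z)"],
  goal_cases)
  case (3 s')
  then show ?case by (auto simp: changes_only_def)
next
  case (11 k s')
  have "L ! scalar s v ! k < n" using nth_L adj_less 11 s by blast
  then show ?case using 11 W c by (auto simp: take_Suc_conv_app_nth)
next
  case (12 s')
  then show ?case using s by (simp add: set_L)
next
  case 13
  then show ?case using deg_le s by simp
qed (use s v in auto)

lemma runs_mark_root:
  assumes s: "ready s" "scalar s ''root'' < n"
  shows "runs W mark_root s (7 * n + 7)
    (\<lambda>s'. ready s' \<and> changes_only {''k'', ''l'', ''u''} {''mark''} s s' \<and>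
       (\<forall>z<n. array s' ''mark'' z =
         of_bool (z = scalar s ''root'' \<or> adj (scalar s ''root'') z)))"
    (is "runs W _ s _ ?Q")
  unfolding mark_root_def
proof (rule runs_Seq)
  let ?v = "scalar s ''root''"
  let ?J = "\<lambda>k s'. changes_only {''k'', ''l'', ''u''} {''mark''} s s' \<and> (\<forall>z<k. array s' ''mark'' z = 0)"
  show "runs W (for_verts ''u'' (Write ''mark'' (Var ''u'') (Const 0))) s (3 * n + 2)
    (\<lambda>s1. runs W (Write ''mark'' (Var ''root'') (Const 1) ;; mark_nbrs ''root'' 1) s1
      (Suc (4 * n + 4)) ?Q)"
  proof (rule runs_for_verts[where K = 1 and J = ?J], goal_cases)
    case (6 s1)
    have c: "changes_only {''k'', ''l'', ''u''} {''mark''} s (set_array ''mark'' ?v 1 s1)"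
      using 6 by simp
    have v: "scalar s1 ''root'' = ?v"
      by (rule changes_only_scalar[of "{''k'', ''l'', ''u''}" "{''mark''}"]) (use 6 in auto)
    have "runs W (mark_nbrs ''root'' 1) (set_array ''mark'' ?v 1 s1) (4 + 4 * n) ?Q"
    proof (rule runs_mono[OF runs_mark_nbrs], goal_cases)
      case (6 s2)
      then show ?case using \<open>?J n s1\<close> v changes_only_trans[OF c, of _ _ s2] by auto
    qed (use 6 v s in auto)
    then show ?case using v s W by simp
  qed (use s W in \<open>auto simp: less_Suc_eq\<close>)
qed simp

lemma runs_pick_nbr:
  assumes s: "ready s" "scalar s ''w'' < n" "\<forall>z<n. array s ''mark'' z \<le> 2"
  shows "runs W pick_nbr s (6 * n + 5)
    (\<lambda>s'. ready s' \<and> changes_only {''k'', ''l'', ''u'', ''x'', ''a''} {} s s' \<and> scalar s' ''a'' < n \<and>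
       ((\<exists>z. adj (scalar s ''w'') z \<and> array s ''mark'' z = 0) \<longrightarrow>
          adj (scalar s ''w'') (scalar s' ''a'') \<and> array s ''mark'' (scalar s' ''a'') = 0))"
    (is "runs W _ s _ ?Q")
proof -
  let ?w = "scalar s ''w''"
  let ?s = "set_scalar ''a'' ?w s"
  let ?J = "\<lambda>k s'. changes_only {''k'', ''l'', ''u'', ''x'', ''a''} {} s s' \<and> scalar s' ''a'' < n \<and>
     ((\<exists>z\<in>set (take k (L ! ?w)). array s ''mark'' z = 0) \<longrightarrow>
        adj ?w (scalar s' ''a'') \<and> array s ''mark'' (scalar s' ''a'') = 0)"
  have "runs W (for_nbrs ''k'' ''l'' ''u'' ''w''
        (Assign ''x'' (Read ''mark'' (Var ''u'')) ;;
         If (Equal (Var ''x'') (Const 0)) (Assign ''a'' (Opd (Var ''u''))) Skip))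
      ?s (4 + 6 * n) ?Q"
  proof (rule runs_for_nbrs[where K = 3 and J = ?J], goal_cases)
    case (3 s')
    then show ?case using s by (auto simp: changes_only_def)
  next
    case (11 k s')
    let ?u = "L ! ?w ! k"
    have u: "adj ?w ?u" "?u < n" using nth_L[of ?w k] adj_less 11 s by auto
    have m: "array s' ''mark'' = array s ''mark''"
      by (rule changes_only_array[of "{''k'', ''l'', ''u'', ''x'', ''a''}" "{}"]) (use 11 in auto)
    have "array s ''mark'' ?u \<le> W" "?u \<le> W" using u s W by (auto intro: order_trans)
    then show ?case using 11 u m by (auto simp: take_Suc_conv_app_nth)
  next
    case (12 s')
    then show ?case using s set_L[of ?w] by auto
  next
    case 13
    then show ?case using deg_le s by simp
  qed (use s in auto)
  then show ?thesis using s W by (simp add: pick_nbr_def)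
qed

lemma runs_pick_far:
  assumes s: "ready s" "scalar s ''w'' < n" "\<forall>z<n. array s ''mark'' z \<le> 2"
  shows "runs W pick_far s (5 * n + 3)
    (\<lambda>s'. ready s' \<and> changes_only {''u'', ''x'', ''y''} {} s s' \<and> scalar s' ''y'' < n \<and>
       (scalar s' ''y'' = scalar s ''w'' \<or> array s ''mark'' (scalar s' ''y'') = 0) \<and>
       ((\<exists>z<n. array s ''mark'' z = 0) \<longrightarrow> array s ''mark'' (scalar s' ''y'') = 0))"
    (is "runs W _ s _ ?Q")
proof -
  let ?w = "scalar s ''w''"
  let ?s = "set_scalar ''y'' ?w s"
  let ?J = "\<lambda>k s'. changes_only {''u'', ''x'', ''y''} {} s s' \<and> scalar s' ''y'' < n \<and>
       (scalar s' ''y'' = scalar s ''w'' \<or> array s ''mark'' (scalar s' ''y'') = 0) \<and>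
       ((\<exists>z<k. array s ''mark'' z = 0) \<longrightarrow> array s ''mark'' (scalar s' ''y'') = 0)"
  have "runs W (for_verts ''u''
        (Assign ''x'' (Read ''mark'' (Var ''u'')) ;;
         If (Equal (Var ''x'') (Const 0)) (Assign ''y'' (Opd (Var ''u''))) Skip))
      ?s (5 * n + 2) ?Q"
  proof (rule runs_for_verts[where K = 3 and J = ?J], goal_cases)
    case (5 k s')
    have m: "array s' ''mark'' = array s ''mark''"
      by (rule changes_only_array[of "{''u'', ''x'', ''y''}" "{}"]) (use 5 in auto)
    have "array s ''mark'' k \<le> W" "k \<le> W" using 5 s W by (auto intro: order_trans)
    then show ?case using 5 m by (auto simp: less_Suc_eq)
  next
    case (6 s')
    then show ?case by auto
  qed (use s in auto)
  then show ?thesis using s W by (simp add: pick_far_def)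
qed

lemma runs_check_far:
  assumes s: "ready s" "scalar s ''w'' < n" "scalar s ''y'' < n" "\<forall>z<n. array s ''mark'' z \<le> 2"
  shows "runs W check_far s (6 * n + 7)
    (\<lambda>s'. ready s' \<and> changes_only {''k'', ''l'', ''u'', ''x'', ''ok'', ''src''} {} s s' \<and>
       scalar s' ''src'' = (if \<exists>z. adj (scalar s ''y'') z \<and> array s ''mark'' z = 2
         then scalar s ''src'' else scalar s ''w''))"
    (is "runs W _ s _ ?Q")
proof -
  let ?y = "scalar s ''y''"
  let ?s = "set_scalar ''ok'' 1 s"
  let ?J = "\<lambda>k s'. changes_only {''k'', ''l'', ''u'', ''x'', ''ok''} {} s s' \<and>
     scalar s' ''ok'' = (if \<exists>z\<in>set (take k (L ! ?y)). array s ''mark'' z = 2 then 0 else 1)"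
  have "runs W (for_nbrs ''k'' ''l'' ''u'' ''y''
        (Assign ''x'' (Read ''mark'' (Var ''u'')) ;;
         If (Equal (Var ''x'') (Const 2)) (Assign ''ok'' (Opd (Const 0))) Skip))
      ?s (6 * n + 4) (\<lambda>s'. ready s' \<and> ?J (deg ?y) s')"
  proof (rule runs_for_nbrs[where K = 3 and J = ?J], goal_cases)
    case (3 s')
    then show ?case using s by (auto simp: changes_only_def)
  next
    case (11 k s')
    let ?u = "L ! ?y ! k"
    have u: "?u < n" using nth_L[of ?y k] adj_less 11 s by auto
    have m: "array s' ''mark'' = array s ''mark''"
      by (rule changes_only_array[of "{''k'', ''l'', ''u'', ''x'', ''ok''}" "{}"]) (use 11 in auto)
    have "array s ''mark'' ?u \<le> W" using u s W by (auto intro: order_trans)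
    then show ?case using 11 u m by (auto simp: take_Suc_conv_app_nth)
  next
    case 13
    then show ?case using deg_le s by simp
  qed (use s in auto)
  then have "runs W (for_nbrs ''k'' ''l'' ''u'' ''y''
        (Assign ''x'' (Read ''mark'' (Var ''u'')) ;;
         If (Equal (Var ''x'') (Const 2)) (Assign ''ok'' (Opd (Const 0))) Skip) ;;
      If (Equal (Var ''ok'') (Const 1)) (Assign ''src'' (Opd (Var ''w''))) Skip) ?s (2 + (4 + 6 * n)) ?Q"
  proof (rule runs_SeqI[where U = 2], goal_cases)
    case (1 s')
    then have J: "ready s'" "?J (deg ?y) s'" by auto
    then have c: "changes_only {''k'', ''l'', ''u'', ''x'', ''ok''} {} s s'" by simp
    have c': "changes_only {''k'', ''l'', ''u'', ''x'', ''ok'', ''src''} {} s s'"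
      using c by (rule changes_only_trans[OF changes_only_refl]) auto
    have "scalar s' ''w'' = scalar s ''w''" "scalar s' ''src'' = scalar s ''src''"
      using changes_only_scalar[OF c] by simp_all
    then show ?case using J c' s W set_L[of ?y] by auto
  qed simp
  then show ?thesis using W by (simp add: check_far_def)
qed

text \<open>Soundness of the test. The default \<open>y = w\<close> cannot pass it, because
  \<open>v\<close> is a neighbour of \<open>w\<close>.\<close>

lemma far_if_marked:
  assumes "adj v w" "y < n"
    and y: "y = w \<or> \<not> adj w y" and disj: "\<not> (\<exists>z. adj y z \<and> adj w z)"
  shows "far_from_some w"
proof -
  have "y \<noteq> w" using disj assms(1) adj_sym by blast
  then have "3 \<le> dist w y"
    using dist_ge_3[of w y] y disj assms adj_sym adj_less by (fastforce simp: verts_eq)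
  then show ?thesis using assms(2) by (auto simp: far_from_some_def verts_eq)
qed

text \<open>The second conjunct of the postcondition that concerns \<open>src\<close> is
  completeness, the first is soundness: \<open>src\<close> only ever changes to a vertex with
  another one at distance 3 or more.\<close>

lemma runs_try_nbr:
  assumes s: "ready s" "scalar s ''root'' = v" "scalar s ''w'' = w" "adj v w"
  shows "runs W try_nbr s (32 * n + 40)
    (\<lambda>s'. ready s' \<and> changes_only {''k'', ''l'', ''u'', ''x'', ''a'', ''y'', ''ok'', ''src''} {''mark''} s s' \<and>
       (scalar s' ''src'' = scalar s ''src'' \<or> scalar s' ''src'' = w \<and> far_from_some w) \<and>
       (detectable v w \<longrightarrow> scalar s' ''src'' = w))"
    (is "runs W _ s _ ?Q")
proof -
  let ?X = "{''k'', ''l'', ''u'', ''x'', ''a'', ''y'', ''ok'', ''src''}"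
  have vw: "v < n" "w < n" "adj w v" using s adj_less adj_sym by blast+
  show ?thesis
    unfolding try_nbr_def
  proof (rule runs_SeqI[where U = "25 * n + 33", OF runs_mark_root], goal_cases)
    case (3 s1)
    then have c1: "changes_only ?X {''mark''} s s1"
      by (elim conjE) (erule changes_only_trans[OF changes_only_refl]; simp)
    have v1: "scalar s1 ''root'' = v" "scalar s1 ''w'' = w" "scalar s1 ''src'' = scalar s ''src''"
      using 3 s by (auto simp: changes_only_def)
    have m1: "\<forall>z<n. array s1 ''mark'' z = of_bool (z = v \<or> adj v z)" using 3 s by simp
    show ?case
    proof (rule runs_SeqI[where U = "19 * n + 28", OF runs_pick_nbr], goal_cases)
      case (4 s2)
      then have c2: "changes_only ?X {''mark''} s s2"
        by (elim conjE) (erule changes_only_trans[OF c1]; simp)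
      have v2: "scalar s2 ''root'' = v" "scalar s2 ''w'' = w" "scalar s2 ''src'' = scalar s ''src''"
        "array s2 ''mark'' = array s1 ''mark''"
        using 4 v1 by (auto simp: changes_only_def)
      define a where "a = scalar s2 ''a''"
      have a: "a < n" "(\<exists>z. adj w z \<and> z \<noteq> v \<and> \<not> adj v z) \<Longrightarrow> adj w a \<and> a \<noteq> v \<and> \<not> adj v a"
        using 4 v1 m1 adj_less by (auto simp: a_def split: if_splits)
      show ?case
      proof (rule runs_SeqI[where U = "15 * n + 24", OF runs_mark_nbrs], goal_cases)
        case (5 s3)
        then have c3: "changes_only ?X {''mark''} s s3"
          by (elim conjE) (erule changes_only_trans[OF c2]; simp)
        have v3: "scalar s3 ''w'' = w" "scalar s3 ''src'' = scalar s ''src''"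
          using 5 v2 by (auto simp: changes_only_def)
        show ?case
        proof (rule runs_SeqI[where U = "11 * n + 20", OF runs_mark_nbrs], goal_cases)
          case (5 s4)
          then have c4: "changes_only ?X {''mark''} s s4"
            by (elim conjE) (erule changes_only_trans[OF c3]; simp)
          have v4: "scalar s4 ''w'' = w" "scalar s4 ''src'' = scalar s ''src''"
            using 5 v3 by (auto simp: changes_only_def)
          have m4: "array s4 ''mark'' z = (if adj w z then 2 else
              if adj a z \<or> z = v \<or> adj v z then 1 else 0)" if "z < n" for z
            using 5 \<open>ready s3 \<and> _\<close> v2 v3 m1 that by (simp add: a_def)
          have m4_le: "\<forall>z<n. array s4 ''mark'' z \<le> 2" using m4 by simp
          show ?case
          proof (rule runs_SeqI[where U = "6 * n + 7", OF runs_pick_far], goal_cases)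
            case (4 s5)
            then have c5: "changes_only ?X {''mark''} s s5"
              by (elim conjE) (erule changes_only_trans[OF c4]; simp)
            have v5: "scalar s5 ''w'' = w" "scalar s5 ''src'' = scalar s ''src''"
              "array s5 ''mark'' = array s4 ''mark''"
              using 4 v4 by (auto simp: changes_only_def)
            define y where "y = scalar s5 ''y''"
            have y: "y < n" "y = w \<or> \<not> adj w y"
              "(\<exists>z<n. array s4 ''mark'' z = 0) \<Longrightarrow> array s4 ''mark'' y = 0"
              using 4 v4 m4 by (auto simp: y_def split: if_splits)
            show ?case
            proof (rule runs_mono[OF runs_check_far], goal_cases)
              case (6 s6)
              then have c6: "changes_only ?X {''mark''} s s6"
                by (elim conjE) (erule changes_only_trans[OF c5]; simp)
              have src: "scalar s6 ''src'' =
                  (if \<exists>z. adj y z \<and> adj w z then scalar s ''src'' else w)"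
              proof -
                have "(\<exists>z. adj y z \<and> array s4 ''mark'' z = 2) \<longleftrightarrow> (\<exists>z. adj y z \<and> adj w z)"
                  using m4 adj_less by (metis one_eq_numeral_iff semiring_norm(85) zero_neq_numeral)
                then show ?thesis using 6 v5 by (auto simp: y_def)
              qed
              have "scalar s6 ''src'' = w" if "detectable v w"
              proof -
                obtain y' where y': "y' < n" "3 \<le> dist w y'"
                  "\<And>a z. adj w a \<Longrightarrow> \<not> adj v a \<Longrightarrow> a \<noteq> v \<Longrightarrow> z < n \<Longrightarrow>
                    \<not> adj v z \<Longrightarrow> \<not> adj w z \<Longrightarrow> \<not> adj a z \<Longrightarrow> z = y'"
                  and a': "adj w a" "a \<noteq> v" "\<not> adj v a"
                  using \<open>detectable v w\<close> a unfolding detectable_def by (auto simp: verts_eq)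
                have far: "w \<noteq> y'" "\<not> adj w y'" "\<forall>z. adj w z \<longrightarrow> \<not> adj z y'"
                  using dist_ge_3[of w y'] y' vw by (auto simp: verts_eq)
                \<comment> \<open>Both \<open>v\<close> and \<open>a\<close> are neighbours of
                  \<open>w\<close>, so \<open>y'\<close> is adjacent to none of \<open>v\<close>,
                  \<open>w\<close>, \<open>a\<close> and stays unmarked. Hence the program finds
                  some unmarked \<open>y\<close>, and uniqueness gives
                  \<open>y = y'\<close>.\<close>
                then have "array s4 ''mark'' y' = 0" using m4[OF y'(1)] vw a' by auto
                then have "array s4 ''mark'' y = 0" using y(3) y'(1) by blast
                then have "y = y'" using m4[OF y(1)] y'(3)[OF a'(1,3,2) y(1)]
                  by (auto split: if_splits)
                then show ?thesis using src far adj_sym by auto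
              qed
              moreover have "far_from_some w" if "\<not> (\<exists>z. adj y z \<and> adj w z)"
                using far_if_marked[OF s(4) y(1,2) that] .
              moreover have "ready s6" using 6 by blast
              ultimately show ?case using c6 src by (auto split: if_splits)
            qed (use 4 v5 m4_le vw in auto)
          qed (use 5 v4 m4_le vw in auto)
        qed (use 5 v3 vw in auto)
      qed (use 4 v2 vw in auto)
    qed (use 3 v1 m1 vw in auto)
  qed (use s vw in auto)
qed

text \<open>A later neighbour that passes the test may replace an earlier one, so a detectable
  \<open>w\<close> only guarantees that the final \<open>src\<close> is far from some
  vertex.\<close>

lemma runs_find_source:
  assumes s: "ready s" "scalar s ''src'' = v" "scalar s ''root'' = v" "v < n"
    and min: "min_degree_vertex v"
  shows "runs W find_source s (32 * length (concat L) + 43 * n + 4)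
    (\<lambda>s'. ready s' \<and> scalar s' ''src'' < n \<and>
       (scalar s' ''src'' = v \<or> far_from_some (scalar s' ''src'')) \<and>
       (\<forall>w. detectable v w \<longrightarrow> far_from_some (scalar s' ''src'')))"
  unfolding find_source_def
proof (rule runs_for_nbrs[where K = "32 * n + 40" and J = "\<lambda>k s'.
    scalar s' ''root'' = v \<and> scalar s' ''src'' < n \<and>
    (scalar s' ''src'' = v \<or> far_from_some (scalar s' ''src'')) \<and>
    (\<forall>w\<in>set (take k (L ! v)). detectable v w \<longrightarrow> far_from_some (scalar s' ''src''))"],
  goal_cases)
  case (3 s')
  then show ?case using s by (auto simp: changes_only_def)
next
  case (11 k s')
  then have w: "adj v (L ! v ! k)" using nth_L s by simp
  have far: "detectable v w \<Longrightarrow> far_from_some w" for w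
    by (auto simp: detectable_def far_from_some_def)
  show ?case
    unfolding s(3)
  proof (rule runs_mono[OF runs_try_nbr[where v = v and w = "L ! v ! k"]], goal_cases)
    case (6 s'')
    then have c: "scalar s'' ''i'' = scalar s' ''i''" "scalar s'' ''j'' = scalar s' ''j''"
      "scalar s'' ''root'' = scalar s' ''root''"
      by (auto simp: changes_only_def)
    then show ?case
      using 6 11 w adj_less[OF w] far[of "L ! v ! k"] s by (auto simp: take_Suc_conv_app_nth)
  qed (use 11 w s in auto)
next
  case (12 s')
  then show ?case using s set_L[of v] by (auto simp: detectable_def)
next
  case 13
  \<comment> \<open>The minimum degree pays for the \<open>O(n)\<close> test of each neighbour:
    \<open>n * deg v\<close> is at most the sum of all degrees.\<close>
  have "n * deg v = (\<Sum>u<n. deg v)" by simp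
  also have "\<dots> \<le> (\<Sum>u<n. deg u)"
    using min s by (intro sum_mono) (auto simp: min_degree_vertex_def verts_eq deg_eq)
  finally have "n * deg v \<le> length (concat L)" by (simp add: sum_deg)
  then show ?case using deg_le[OF s(4)] by (simp add: s(3) algebra_simps)
qed (use s in auto)

end

section \<open>The complete algorithm\<close>

text \<open>The path is written from \<open>last\<close> back to the source. The final round reads
  one parent beyond it, which is the source again.\<close>

definition output_path :: program where
  "output_path =
     (Assign ''x'' (Opd (Var ''last'')) ;;
      Assign ''k'' (Opd (Const 0)) ;;
      While (Less (Var ''k'') (Var ''len''))
        (Write ''out'' (Var ''k'') (Var ''x'') ;;
         Assign ''x'' (Read ''par'' (Var ''x'')) ;;
         Assign ''k'' (Add (Var ''k'') (Const 1))))"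

text \<open>Since \<open>len\<close> counts vertices, \<open>len < 4\<close> says that the
  eccentricity of \<open>root\<close> is at most 2; only then is another source sought.\<close>

definition diameter_path :: program where
  "diameter_path =
     (find_min_degree ;;
      Assign ''src'' (Opd (Var ''root'')) ;;
      bfs ;;
      If (Less (Var ''len'') (Const 4)) (find_source ;; bfs) Skip ;;
      output_path)"

context input
begin

lemma bfs_tree_less: "bfs_tree src P \<Longrightarrow> v < n \<Longrightarrow> P v < n"
  using adj_less by (cases "v = src") (auto simp: bfs_tree_def verts_eq)

lemma bfs_tree_path:
  fixes P src l
  defines "p \<equiv> map (\<lambda>i. (P ^^ i) l) [0..<Suc (dist src l)]"
  assumes tree: "bfs_tree src P" and src: "src < n" and l: "l < n"
  shows "shortest_path G p" and "last p = src"
proof -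
  let ?p = "map (\<lambda>i. (P ^^ i) l) [0..<Suc (dist src l)]"
  \<comment> \<open>The \<open>i\<close>-th ancestor of \<open>l\<close> is \<open>i\<close> steps
    closer to \<open>src\<close>, so before the last step it is not \<open>src\<close> and has a
    proper parent.\<close>
  have d: "(P ^^ i) l < n \<and> dist src ((P ^^ i) l) = dist src l - i" if "i \<le> dist src l" for i
    using that
  proof (induction i)
    case (Suc i)
    let ?v = "(P ^^ i) l"
    have v: "?v < n" "dist src ?v = Suc (dist src l - Suc i)" using Suc by auto
    then have "?v \<noteq> src" using dist_0_iff[of src src] src by (auto simp: verts_eq)
    then have "dist src ?v = Suc (dist src (P ?v))" using tree v by (simp add: bfs_tree_def verts_eq)
    then show ?case using v bfs_tree_less[OF tree v(1)] by simp
  qed (use l in simp)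
  have step: "adj ((P ^^ i) l) ((P ^^ Suc i) l) \<and>
      dist src ((P ^^ i) l) = Suc (dist src ((P ^^ Suc i) l))" if "i < dist src l" for i
  proof -
    let ?v = "(P ^^ i) l"
    have v: "?v < n" "dist src ?v \<noteq> 0" using d[of i] that by auto
    then have "?v \<noteq> src" using dist_0_iff[of src src] src by (auto simp: verts_eq)
    then show ?thesis using tree v adj_sym by (simp add: bfs_tree_def verts_eq)
  qed
  show last: "last p = src"
    unfolding p_def
    using d[of "dist src l"] dist_0_iff[of src "(P ^^ dist src l) l"] src
    by (simp add: verts_eq)
  show "shortest_path G p"
    unfolding p_def
  proof (rule descending_path[of src])
    show "set ?p \<subseteq> verts G" using d by (auto simp: verts_eq less_Suc_eq_le)
    fix i assume "Suc i < length ?p"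
    then show "adj (?p ! i) (?p ! Suc i) \<and> dist src (?p ! i) = Suc (dist src (?p ! Suc i))"
      using step[of i] by (simp del: upt_Suc)
  qed (use src last in \<open>auto simp: verts_eq p_def\<close>)
qed

lemma runs_output_path:
  assumes s: "ready s" "bfs_tree src (array s ''par'')" "scalar s ''last'' < n" "scalar s ''len'' \<le> n"
  shows "runs W output_path s (4 * n + 3)
    (\<lambda>s'. result_of s' =
       Some (map (\<lambda>i. (array s ''par'' ^^ i) (scalar s ''last'')) [0..<scalar s ''len'']))"
    (is "runs W _ s _ ?Q")
proof -
  let ?P = "array s ''par''" and ?l = "scalar s ''last''" and ?len = "scalar s ''len''"
  let ?I = "\<lambda>s'. ready s' \<and> changes_only {''x'', ''k''} {''out''} s s' \<and> scalar s' ''k'' \<le> ?len \<and>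
    scalar s' ''x'' = (?P ^^ scalar s' ''k'') ?l \<and>
    (\<forall>i<scalar s' ''k''. array s' ''out'' i = (?P ^^ i) ?l)"
  have less: "(?P ^^ i) ?l < n" for i
    by (induction i) (use s bfs_tree_less in auto)
  have "runs W (While (Less (Var ''k'') (Var ''len''))
        (Write ''out'' (Var ''k'') (Var ''x'') ;;
         Assign ''x'' (Read ''par'' (Var ''x'')) ;;
         Assign ''k'' (Add (Var ''k'') (Const 1))))
      (set_scalar ''k'' 0 (set_scalar ''x'' ?l s)) (4 * n + 1) ?Q"
  proof (rule runs_While[where I = ?I and V = "\<lambda>s'. 4 * (?len - scalar s' ''k'')"], goal_cases)
    case (2 s')
    then have c: "array s' ''par'' = ?P" "scalar s' ''len'' = ?len" by (auto simp: changes_only_def)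
    have "scalar s' ''x'' \<le> W" "?P (scalar s' ''x'') \<le> W"
      using less[of "scalar s' ''k''"] less[of "Suc (scalar s' ''k'')"] 2 W by simp_all
    moreover have "scalar s' ''k'' < n" using 2 c s by simp
    ultimately have "runs W (Write ''out'' (Var ''k'') (Var ''x'') ;;
         Assign ''x'' (Read ''par'' (Var ''x'')) ;;
         Assign ''k'' (Add (Var ''k'') (Const 1))) s' 3
       (\<lambda>s''. ?I s'' \<and> 3 + 1 + 4 * (?len - scalar s'' ''k'') \<le> 4 * (?len - scalar s' ''k''))"
      using 2 c W by (auto simp: less_Suc_eq)
    then show ?case by blast
  next
    case (3 s')
    then have "scalar s' ''k'' = ?len" "scalar s' ''len'' = ?len" "scalar s' ''reject'' = 0"
      by (auto simp: changes_only_def ready_def)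
    with 3 show ?case by (auto simp: result_of_def)
  qed (use s in auto)
  then show ?thesis using s W by (simp add: output_path_def eval_nat_numeral)
qed

definition correct_answer :: "nat list option \<Rightarrow> bool" where
  "correct_answer res \<longleftrightarrow> (\<exists>p. res = Some p \<and> shortest_path G p \<and>
     (free_of G P2_plus_2P1 \<longrightarrow> diametral_path G p))"

lemma runs_output_correct:
  assumes s: "ready s" "bfs_tree src (array s ''par'')" "farthest src (scalar s ''last'')" "src < n"
    and len: "scalar s ''len'' = Suc (dist src (scalar s ''last''))"
    and diam: "free_of G P2_plus_2P1 \<Longrightarrow> dist src (scalar s ''last'') = diam G"
  shows "runs W output_path s (4 * n + 3) (\<lambda>s'. correct_answer (result_of s'))"
proof -
  let ?l = "scalar s ''last''"
  have l: "?l < n" using s(3) by (simp add: farthest_def verts_eq)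
  have "scalar s ''len'' \<le> n" using len dist_less[OF s(4) l] by simp
  from runs_output_path[OF s(1,2) l this] show ?thesis
  proof (rule runs_mono, goal_cases)
    case (2 s')
    let ?p = "map (\<lambda>i. (array s ''par'' ^^ i) ?l) [0..<Suc (dist src ?l)]"
    note path = bfs_tree_path[OF s(2,4) l]
    have "hd ?p = ?l" by (simp add: hd_map del: upt_Suc)
    then have "dist (hd ?p) (last ?p) = dist src ?l"
      using path(2) dist_sym[of src ?l] s(4) l by (simp add: verts_eq del: upt_Suc)
    then show ?case
      using 2 path(1) diam len by (auto simp: correct_answer_def diametral_path_def simp del: upt_Suc)
  qed simp
qed

lemma runs_diameter_path:
  "runs W diameter_path (input_state L) (80 * n + 50 * length (concat L) + 45)
     (\<lambda>s. correct_answer (result_of s))"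
  unfolding diameter_path_def
proof (rule runs_SeqI[where U = "71 * n + 50 * length (concat L) + 42",
    OF runs_find_min_degree[OF ready_input]], goal_cases)
  case (1 s1)
  define v where "v = scalar s1 ''root''"
  have min: "min_degree_vertex v" using 1 by (simp add: v_def)
  then have v: "v < n" by (simp add: min_degree_vertex_def verts_eq)
  let ?s1 = "set_scalar ''src'' v s1"
  have "runs W (bfs ;; If (Less (Var ''len'') (Const 4)) (find_source ;; bfs) Skip ;; output_path)
    ?s1 (41 + (71 * n + 50 * length (concat L))) (\<lambda>s. correct_answer (result_of s))"
  proof (rule runs_SeqI[where U = "59 * n + 41 * length (concat L) + 30", OF runs_bfs[where src = v]],
      goal_cases)
    case (4 s2)
    then have s2: "ready s2" "scalar s2 ''src'' = v" "scalar s2 ''root'' = v"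
      by (auto simp: changes_only_def v_def)
    let ?Q = "\<lambda>s3. runs W output_path s3 (4 * n + 3) (\<lambda>s. correct_answer (result_of s))"
    have branch: "runs W (find_source ;; bfs) s2 (20 + (55 * n + 41 * length (concat L))) ?Q"
      if near: "dist v (scalar s2 ''last'') < 3"
    proof (rule runs_SeqI[where U = "12 * n + 9 * length (concat L) + 11",
          OF runs_find_source[OF s2 v min]], goal_cases)
      case (1 s3)
      show ?case
      proof (rule runs_mono[OF runs_bfs[OF _ refl]], goal_cases)
        case (4 s4)
        show ?case
        proof (rule runs_output_correct[where src = "scalar s3 ''src''"])
          assume free: "free_of G P2_plus_2P1"
          show "dist (scalar s3 ''src'') (scalar s4 ''last'') = diam G"
            by (rule near_source_diam[OF free min _ near])
              (use 1 4 \<open>ready s2 \<and> _\<close> in \<open>auto simp: verts_eq\<close>)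
        qed (use 1 4 in auto)
      qed (use 1 in auto)
    qed simp
    have skip: "?Q s2" if far: "\<not> dist v (scalar s2 ''last'') < 3"
      by (rule runs_output_correct[where src = v])
        (use 4 far v far_source_diam[OF _ min] in auto)
    show ?case
    proof (rule runs_Seq)
      show "runs W (If (Less (Var ''len'') (Const 4)) (find_source ;; bfs) Skip) s2
        (Suc (20 + (55 * n + 41 * length (concat L)))) ?Q"
        using 4 branch skip by auto
    qed simp
  qed (use 1 v in auto)
  then show ?case using v W by (simp add: v_def)
qed simp

end

theorem theorem10:
  "\<exists>(A :: program) (c :: nat). \<forall>(G :: nat graph) (L :: nat list list).
     simple_graph G \<longrightarrow> connected_graph G \<longrightarrow> adjacency_lists G L \<longrightarrow>
     (\<exists>res. computes_in_linear_time A c G L res \<and>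
        (case res of
           None \<Rightarrow> \<not> free_of G P2_plus_2P1
         | Some p \<Rightarrow> shortest_path G p \<and>
             (free_of G P2_plus_2P1 \<longrightarrow> diametral_path G p)))"
\<comment> \<open>The constant is 80 + 45: the additive 45 is absorbed by \<open>n \<ge> 1\<close>,
  and 50 times the total list length is at most \<open>100 * m\<close>.\<close>
proof (intro exI[of _ diameter_path] exI[of _ 125] allI impI)
  fix G :: "nat graph" and L :: "nat list list"
  assume G: "simple_graph G" "connected_graph G" "adjacency_lists G L"
  let ?n = "card (verts G)" and ?m = "card (edges G)"
  let ?W = "(?n + ?m + 1) ^ 125"
  \<comment> \<open>A first instance, with the least admissible word bound, supplies the size
    relations that show the real bound to be admissible.\<close>
  have 0: "input G L (length L + length (concat L) + 2)"
    by unfold_locales (use G in auto)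
  have n: "length L = ?n" "0 < length L"
    using input.verts_eq[OF 0] input.n_pos[OF 0] by auto
  have m: "length (concat L) \<le> 2 * ?m" by (rule input.length_concat_le[OF 0])
  have "length L + length (concat L) + 2 \<le> (?n + ?m + 1) ^ 2"
  proof -
    \<comment> \<open>Here \<open>n \<ge> 1\<close> turns \<open>n + 2 * m + 2\<close> into at most
      \<open>1 + 2 * (n + m)\<close>, which the square of \<open>n + m + 1\<close>
      dominates.\<close>
    have "length L + length (concat L) + 2 \<le> 1 + 2 * (?n + ?m)" using n m by arith
    also have "\<dots> \<le> (?n + ?m + 1) ^ 2" by (simp add: power2_eq_square algebra_simps)
    finally show ?thesis .
  qed
  also have "\<dots> \<le> ?W" by (rule power_increasing) simp_all
  finally interpret input G L ?W
    by unfold_locales (use G in auto)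
  obtain t s where s: "exec ?W diameter_path (input_state L) t s"
    "t \<le> 80 * length L + 50 * length (concat L) + 45" "correct_answer (result_of s)"
    using runs_diameter_path unfolding runs_def by blast
  have "t \<le> 80 * ?n + 50 * (2 * ?m) + 45 * ?n"
    by (rule order_trans[OF s(2)], intro add_mono mult_left_mono) (use n m in auto)
  also have "\<dots> \<le> 125 * (?n + ?m)" by simp
  finally have "t \<le> 125 * (?n + ?m)" .
  with s have "computes_in_linear_time diameter_path 125 G L (result_of s)"
    unfolding computes_in_linear_time_def by blast
  with s(3) show "\<exists>res. computes_in_linear_time diameter_path 125 G L res \<and>
        (case res of
           None \<Rightarrow> \<not> free_of G P2_plus_2P1
         | Some p \<Rightarrow> shortest_path G p \<and>
             (free_of G P2_plus_2P1 \<longrightarrow> diametral_path G p))"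
    by (auto simp: correct_answer_def split: option.splits)
qed

end
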